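(* For every fixed $p\in(0,1)$, the biased random $2$-SAT problem with bias $p$ has a sharp satisfiability threshold at \[\alpha_2(p)=\frac{1}{4p(1-p)}=\frac{1}{1-4b^2},\quad\text{where } p=\tfrac12-b;\] that is, for every fixed $\varepsilon>0$, $\Phi^p_2(m,n)$ is satisfiable with probability $1-o(1)$ if $m\le(1-\varepsilon)\frac{n}{4p(1-p)}$ and unsatisfiable with probability $1-o(1)$ if $m\ge(1+\varepsilon)\frac{n}{4p(1-p)}$, as $n\to\infty$.
   Context: Fix $n$ Boolean variables and $p\in(0,1)$. A $p$-biased random $k$-clause is formed by choosing a $k$-subset of the variables uniformly at random and then, independently for each chosen variable $x$, including the literal $x$ with probability $p$ and the literal $\neg x$ otherwise. $\Phi^p_k(m,n)$ is the conjunction of $m$ i.i.d. $p$-biased random $k$-clauses. *)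

theory Defs
  imports "HOL-Probability.Probability"
begin

text \<open>The literal \<open>(x, True)\<close> is the variable \<open>x\<close>, and \<open>(x, False)\<close> is its negation. A clause is
  the disjunction of a set of literals, and a formula is the conjunction of a list of clauses
  (so repeated clauses are kept apart). The \<open>n\<close> Boolean variables are \<open>0, \<dots>, n - 1\<close>.\<close>

type_synonym literal = "nat \<times> bool"
type_synonym clause = "literal set"
type_synonym formula = "clause list"

definition satisfies :: "(nat \<Rightarrow> bool) \<Rightarrow> formula \<Rightarrow> bool" where
  "satisfies \<sigma> F \<longleftrightarrow> (\<forall>C\<in>set F. \<exists>(x, s)\<in>C. \<sigma> x = s)"

definition satisfiable :: "formula \<Rightarrow> bool" where
  "satisfiable F \<longleftrightarrow> (\<exists>\<sigma>. satisfies \<sigma> F)"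

text \<open>Meaningful only for \<open>k \<le> n\<close>, since otherwise there are no \<open>k\<close>-subsets to choose from.\<close>

definition biased_clause :: "real \<Rightarrow> nat \<Rightarrow> nat \<Rightarrow> clause pmf" where
  "biased_clause p k n =
     do {
       S \<leftarrow> pmf_of_set {S. S \<subseteq> {..<n} \<and> card S = k};
       sgn \<leftarrow> Pi_pmf S False (\<lambda>_. bernoulli_pmf p);
       return_pmf ((\<lambda>x. (x, sgn x)) ` S)
     }"

definition biased_formula :: "real \<Rightarrow> nat \<Rightarrow> nat \<Rightarrow> nat \<Rightarrow> formula pmf" where
  "biased_formula p k m n = replicate_pmf m (biased_clause p k n)"

text \<open>The number of clauses is an arbitrary sequence \<open>m\<close> subject to the stated bound, so the
  convergence is uniform over all admissible numbers of clauses.\<close>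

definition sharp_sat_threshold :: "real \<Rightarrow> nat \<Rightarrow> real \<Rightarrow> bool" where
  "sharp_sat_threshold p k \<alpha> \<longleftrightarrow>
     (\<forall>\<epsilon>>0. \<forall>m :: nat \<Rightarrow> nat.
        ((\<forall>\<^sub>F n in sequentially. real (m n) \<le> (1 - \<epsilon>) * (\<alpha> * real n)) \<longrightarrow>
           (\<lambda>n. measure_pmf.prob (biased_formula p k (m n) n) {F. satisfiable F})
             \<longlonglongrightarrow> 1) \<and>
        ((\<forall>\<^sub>F n in sequentially. real (m n) \<ge> (1 + \<epsilon>) * (\<alpha> * real n)) \<longrightarrow>
           (\<lambda>n. measure_pmf.prob (biased_formula p k (m n) n) {F. \<not> satisfiable F})
             \<longlonglongrightarrow> 1))"

end

theory Submission
  imports Defs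
begin

text \<open>A 2-clause \<open>{neg a, b}\<close> is the implication \<open>a \<rightarrow> b\<close>, and a given clause on literals \<open>l, l'\<close> has
  probability \<open>2 q(l) q(l') / (n (n - 1))\<close> with \<open>q = p\<close> or \<open>q = 1 - p\<close>. Along a chain of implications
  every inner literal occurs once with each sign, so each further step contributes a factor
  \<open>2 n \<cdot> 2 m / (n (n - 1)) \<cdot> p (1 - p) \<approx> 4 p (1 - p) m / n\<close> to an expected number of chains,
  whatever the signs are.

  Below the threshold, an unsatisfiable formula contains a bicycle (Chvatal and Reed), and the
  expected number of bicycles is \<open>O(1 / n)\<close>. Above it, the second moment method is applied to snakes,
  chains of \<open>2 t\<close> implications \<open>\<not> y \<rightarrow> \<dots> \<rightarrow> y \<rightarrow> \<dots> \<rightarrow> \<not> y\<close> with \<open>t\<close> a small power of \<open>n\<close>. Conditioned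
  on one snake, the expected number of snakes is a sum over closed walks for a rank-one kernel
  perturbed by the implications of the given snake, and a supersolution of that kernel shows that the
  perturbation is negligible.\<close>

section \<open>Occurrences of clauses at prescribed positions\<close>

text \<open>Overlaps are the obstacle in the second moment: two snakes may share segments in many
  patterns. Counting clauses at positions of the list avoids classifying them. Once a snake is
  pinned to given positions, all other positions still carry independent fresh clauses, so the
  conditional weight of a second snake factorises clause by clause: an indicator at a pinned
  position, a probability elsewhere. Summing over positions yields one kernel entry per clause, and
  all overlap patterns are covered at once, including the coincidence of both snakes. The size of t
  is squeezed from two sides. A snake has 2t clauses on only 2t - 1 variables, so the expected
  number is about (4p(1-p)m/n)^(2t) / (2n), and t must exceed a multiple of log n. Walks that end on
  the given snake cost a relative error of order t^5 / n, so t must stay below n^(1/5). Both moment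
  estimates hold for each single m within the stated ratio to n, so arbitrary sequences m are
  covered directly.\<close>

definition neg :: "literal \<Rightarrow> literal" where "neg l = (fst l, \<not> snd l)"

definition bias :: "real \<Rightarrow> literal \<Rightarrow> real" where
  "bias p l = (if snd l then p else 1 - p)"

definition lits :: "nat \<Rightarrow> literal set" where "lits n = {..<n} \<times> UNIV"

lemma neg_neg [simp]: "neg (neg l) = l" by (simp add: neg_def)
lemma fst_neg [simp]: "fst (neg l) = fst l" by (simp add: neg_def)
lemma neg_neq [simp]: "neg l \<noteq> l" "l \<noteq> neg l" by (auto simp: neg_def prod_eq_iff)
lemma neg_eq_iff [simp]: "neg a = neg b \<longleftrightarrow> a = b" by (auto simp: neg_def prod_eq_iff)

lemma same_variable_iff: "fst a = fst b \<longleftrightarrow> a = b \<or> a = neg b"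
  by (auto simp: neg_def prod_eq_iff)

lemma bias_mult_neg: "bias p l * bias p (neg l) = p * (1 - p)"
  by (simp add: bias_def neg_def)

lemma mem_lits: "l \<in> lits n \<longleftrightarrow> fst l < n" by (cases l) (simp add: lits_def)
lemma neg_mem_lits [simp]: "neg l \<in> lits n \<longleftrightarrow> l \<in> lits n" by (simp add: mem_lits)
lemma finite_lits [simp]: "finite (lits n)" by (simp add: lits_def)
lemma card_lits: "card (lits n) = 2 * n" by (simp add: lits_def card_cartesian_product)

section \<open>Law of a single biased 2-clause\<close>

lemma biased_clause_2_support:
  assumes "2 \<le> n" "C \<in> set_pmf (biased_clause p 2 n)"
  shows "\<exists>a b. C = {a, b} \<and> fst a \<noteq> fst b \<and> a \<in> lits n \<and> b \<in> lits n"
proof -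
  let ?SS = "{S. S \<subseteq> {..<n} \<and> card S = 2}"
  have fin: "finite ?SS" by simp
  have "{0, 1} \<in> ?SS" using assms by auto
  then have ne: "?SS \<noteq> {}" by blast
  obtain S s where S: "S \<in> ?SS" and C: "C = (\<lambda>x. (x, s x)) ` S"
    using assms(2) set_pmf_of_set[OF ne fin] by (auto simp: biased_clause_def)
  obtain x y where "S = {x, y}" "x \<noteq> y" using S by (auto simp: card_2_iff)
  then have "C = {(x, s x), (y, s y)} \<and> x < n \<and> y < n" using S C by auto
  then have "C = {(x, s x), (y, s y)} \<and> fst (x, s x) \<noteq> fst (y, s y) \<and> (x, s x) \<in> lits n \<and> (y, s y) \<in> lits n"
    using \<open>x \<noteq> y\<close> by (simp add: mem_lits)
  then show ?thesis by blast
qed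

lemma pmf_biased_clause_2:
  assumes p: "0 < p" "p < 1" and n: "2 \<le> n"
    and ab: "a \<in> lits n" "b \<in> lits n" "fst a \<noteq> fst b"
  shows "pmf (biased_clause p 2 n) {a, b} = 2 / (real n * (real n - 1)) * bias p a * bias p b"
proof -
  let ?SS = "{S. S \<subseteq> {..<n} \<and> card S = 2}"
  let ?P = "\<lambda>S. Pi_pmf S False (\<lambda>_. bernoulli_pmf p)"
  let ?g = "\<lambda>S s. (\<lambda>x. (x, s x)) ` S :: clause"
  define S0 where "S0 = {fst a, fst b}"
  \<comment> \<open>Off \<open>S0\<close> the pattern must take the value \<open>False\<close>, the
    default of \<open>Pi_pmf\<close>; it is then the only pattern in the support that produces the
    clause.\<close>
  define s0 where "s0 = (\<lambda>x. if x = fst a then snd a else if x = fst b then snd b else False)"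
  have fin: "finite ?SS" by simp
  have "{0, 1} \<in> ?SS" using n by auto
  then have ne: "?SS \<noteq> {}" by blast
  have S0: "S0 \<in> ?SS" using ab by (auto simp: S0_def mem_lits)
  have card: "real (card ?SS) = real n * (real n - 1) / 2"
  proof -
    have "card ?SS = n choose 2" using n_subsets[of "{..<n}" 2] by simp
    then have "2 * card ?SS = n * (n - 1)"
      by (cases n) (simp_all add: choose_two)
    then have "real (2 * card ?SS) = real (n * (n - 1))" by simp
    then show ?thesis using n by (simp add: of_nat_diff)
  qed
  have bc: "biased_clause p 2 n = pmf_of_set ?SS \<bind> (\<lambda>S. map_pmf (?g S) (?P S))"
    by (simp add: biased_clause_def map_pmf_def)
  \<comment> \<open>The variable set can be read off a clause by \<open>fst\<close>, so
    \<open>S0\<close> alone contributes to the mixture.\<close>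
  have zero: "pmf (map_pmf (?g S) (?P S)) {a, b} = 0" if "S \<noteq> S0" for S
  proof -
    have "fst ` ?g S s = S" for s by force
    moreover have "fst ` {a, b} = S0" by (auto simp: S0_def)
    ultimately have "{a, b} \<noteq> ?g S s" for s using that by metis
    then show ?thesis by (auto simp: pmf_eq_0_set_pmf)
  qed
  have g0: "?g S0 s0 = {a, b}" using ab by (auto simp: S0_def s0_def)
  have "inj_on (?g S0) (set_pmf (?P S0))"
  proof (rule inj_onI)
    fix s s' assume s: "s \<in> set_pmf (?P S0)" "s' \<in> set_pmf (?P S0)" and eq: "?g S0 s = ?g S0 s'"
    show "s = s'"
    proof
      fix x show "s x = s' x"
      proof (cases "x \<in> S0")
        case True
        then have "(x, s x) \<in> ?g S0 s'" using eq by blast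
        then show ?thesis by auto
      next
        case False
        have "finite S0" by (simp add: S0_def)
        then show ?thesis using s False set_Pi_pmf_subset[of S0 False "\<lambda>_. bernoulli_pmf p"] by auto
      qed
    qed
  qed
  moreover have pm: "pmf (?P S0) s0 = bias p a * bias p b"
    using ab p by (subst pmf_Pi') (auto simp: S0_def s0_def bias_def)
  moreover have "s0 \<in> set_pmf (?P S0)" using pm p by (auto simp: set_pmf_iff bias_def split: if_splits)
  ultimately have one: "pmf (map_pmf (?g S0) (?P S0)) {a, b} = bias p a * bias p b"
    using pmf_map_inj[of "?g S0" "?P S0" s0] g0 by simp
  have "pmf (biased_clause p 2 n) {a, b} = (\<Sum>S\<in>?SS. pmf (map_pmf (?g S) (?P S)) {a, b}) / card ?SS"
    unfolding bc by (rule pmf_bind_pmf_of_set[OF ne fin])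
  also have "(\<Sum>S\<in>?SS. pmf (map_pmf (?g S) (?P S)) {a, b})
     = (\<Sum>S\<in>{S0}. pmf (map_pmf (?g S) (?P S)) {a, b})"
    by (rule sum.mono_neutral_right) (use fin S0 zero in auto)
  finally show ?thesis using one card n by (simp add: field_simps)
qed

text \<open>Off the support the probability is 0, so the product bound needs no side conditions on
  \<open>a\<close> and \<open>b\<close>, and sums over arbitrary lists of literals can be bounded by
  it.\<close>

lemma pmf_biased_clause_2_le:
  assumes p: "0 < p" "p < 1" and n: "2 \<le> n"
  shows "pmf (biased_clause p 2 n) {a, b} \<le> 2 / (real n * (real n - 1)) * bias p a * bias p b"
proof (cases "{a, b} \<in> set_pmf (biased_clause p 2 n)")
  case True
  then obtain a' b' where *: "{a, b} = {a', b'}" "fst a' \<noteq> fst b'" "a' \<in> lits n" "b' \<in> lits n"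
    using biased_clause_2_support[OF n] by metis
  then have "a \<in> lits n \<and> b \<in> lits n \<and> fst a \<noteq> fst b" by (auto simp: doubleton_eq_iff)
  then show ?thesis using pmf_biased_clause_2[OF p n] by simp
next
  case False
  then show ?thesis using p n by (simp add: pmf_eq_0_set_pmf[symmetric] bias_def)
qed

section \<open>Product formulas for clauses at fixed positions\<close>

lemma set_replicate_pmf_lists:
  "F \<in> set_pmf (replicate_pmf m P) \<Longrightarrow> length F = m \<and> set F \<subseteq> set_pmf P"
  by (auto simp: set_replicate_pmf)

lemma prob_pair_pmf_Times:
  "measure_pmf.prob (pair_pmf P Q) (A \<times> B) = measure_pmf.prob P A * measure_pmf.prob Q B"
proof -
  have "measure_pmf.prob (pair_pmf P Q) (A \<times> B)
      = measure_pmf.prob (pair_pmf P Q) ((A \<times> B) \<inter> set_pmf (pair_pmf P Q))"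
    by (rule measure_Int_set_pmf[symmetric])
  also have "(A \<times> B) \<inter> set_pmf (pair_pmf P Q) = (A \<inter> set_pmf P) \<times> (B \<inter> set_pmf Q)" by auto
  also have "measure_pmf.prob (pair_pmf P Q) \<dots>
      = measure_pmf.prob P (A \<inter> set_pmf P) * measure_pmf.prob Q (B \<inter> set_pmf Q)"
    by (rule measure_pmf_prob_product) auto
  finally show ?thesis by (simp add: measure_Int_set_pmf)
qed

lemma prob_replicate_pmf_at:
  assumes "finite I" "I \<subseteq> {..<m}"
  shows "measure_pmf.prob (replicate_pmf m P) {F. \<forall>i\<in>I. F ! i = c i} = (\<Prod>i\<in>I. pmf P (c i))"
  using assms
proof (induction m arbitrary: I c)
  case 0
  then show ?case by simp
next
  case (Suc m)
  define I' where "I' = {i. Suc i \<in> I}"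
  have fI': "finite I'" unfolding I'_def using Suc.prems(1) by (simp add: finite_vimageI[of I Suc, unfolded vimage_def])
  have I's: "I' \<subseteq> {..<m}" using Suc.prems(2) by (auto simp: I'_def)
  have I: "I = (I \<inter> {0}) \<union> Suc ` I'"
  proof (intro set_eqI)
    fix i show "i \<in> I \<longleftrightarrow> i \<in> (I \<inter> {0}) \<union> Suc ` I'" by (cases i) (auto simp: I'_def)
  qed
  let ?R = "replicate_pmf m P"
  have ev: "(\<forall>i\<in>I. (x # F) ! i = c i) \<longleftrightarrow> (0 \<in> I \<longrightarrow> x = c 0) \<and> (\<forall>i\<in>I'. F ! i = c (Suc i))" for x F
    unfolding I'_def by (auto simp: nth_Cons split: nat.splits)
  have vim: "(\<lambda>(x, xs). x # xs) -` {F. \<forall>i\<in>I. F ! i = c i}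
      = {x. 0 \<in> I \<longrightarrow> x = c 0} \<times> {F. \<forall>i\<in>I'. F ! i = c (Suc i)}"
    using ev by auto
  have "measure_pmf.prob (replicate_pmf (Suc m) P) {F. \<forall>i\<in>I. F ! i = c i}
     = measure_pmf.prob (map_pmf (\<lambda>(x, xs). x # xs) (pair_pmf P ?R)) {F. \<forall>i\<in>I. F ! i = c i}"
    by (simp add: pair_pmf_def map_bind_pmf map_pmf_def bind_assoc_pmf bind_return_pmf)
  also have "\<dots> = measure_pmf.prob (pair_pmf P ?R)
      ({x. 0 \<in> I \<longrightarrow> x = c 0} \<times> {F. \<forall>i\<in>I'. F ! i = c (Suc i)})"
    unfolding measure_map_pmf vim ..
  also have "\<dots> = measure_pmf.prob P {x. 0 \<in> I \<longrightarrow> x = c 0} * (\<Prod>i\<in>I'. pmf P (c (Suc i)))"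
    by (subst prob_pair_pmf_Times) (use Suc.IH[OF fI' I's] in auto)
  also have "measure_pmf.prob P {x. 0 \<in> I \<longrightarrow> x = c 0} = (\<Prod>i\<in>I\<inter>{0}. pmf P (c i))"
    by (cases "0 \<in> I") (auto simp: measure_pmf_single)
  also have "(\<Prod>i\<in>I'. pmf P (c (Suc i))) = (\<Prod>i\<in>Suc ` I'. pmf P (c i))"
    by (simp add: prod.reindex)
  also have "(\<Prod>i\<in>I\<inter>{0}. pmf P (c i)) * (\<Prod>i\<in>Suc ` I'. pmf P (c i)) = (\<Prod>i\<in>I. pmf P (c i))"
    by (subst prod.union_disjoint[symmetric]) (use fI' I in auto)
  finally show ?case .
qed

text \<open>The form needed to correlate two snakes: positions in \<open>I\<close> are already
  decided by \<open>a\<close>, so a further request there contributes 0 or 1, while a new position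
  contributes an independent factor.\<close>

lemma prob_replicate_pmf_zip:
  assumes "finite I" "I \<subseteq> {..<m}" "length is = length cs" "distinct is" "set is \<subseteq> {..<m}"
  shows "measure_pmf.prob (replicate_pmf m P)
           {F. (\<forall>i\<in>I. F ! i = a i) \<and> (\<forall>(i, c)\<in>set (zip is cs). F ! i = c)}
     = (\<Prod>i\<in>I. pmf P (a i)) *
       prod_list (map (\<lambda>(i, c). if i \<in> I then of_bool (a i = c) else pmf P c) (zip is cs))"
  using assms(3,1,2,4,5)
proof (induction "is" cs arbitrary: I a rule: list_induct2)
  case Nil
  then show ?case by (simp add: prob_replicate_pmf_at)
next
  case (Cons i "is" c cs)
  show ?case
  proof (cases "i \<in> I")
    case True
    show ?thesis
    proof (cases "a i = c")
      case eq: True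
      have "{F. (\<forall>j\<in>I. F ! j = a j) \<and> (\<forall>(j, c)\<in>set (zip (i # is) (c # cs)). F ! j = c)}
         = {F. (\<forall>j\<in>I. F ! j = a j) \<and> (\<forall>(j, c)\<in>set (zip is cs). F ! j = c)}"
        using True eq by auto
      then show ?thesis using Cons True eq by simp
    next
      case False
      then have "{F. (\<forall>j\<in>I. F ! j = a j) \<and> (\<forall>(j, c)\<in>set (zip (i # is) (c # cs)). F ! j = c)} = {}"
        using True by auto
      then have "measure_pmf.prob (replicate_pmf m P)
         {F. (\<forall>j\<in>I. F ! j = a j) \<and> (\<forall>(j, c)\<in>set (zip (i # is) (c # cs)). F ! j = c)} = 0"
        by (simp only: measure_empty)
      then show ?thesis using True False by simp
    qed
  next
    case False
    \<comment> \<open>The new position joins the decided ones. As the list of positions is distinct,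
      later requests do not see the change of \<open>a\<close>.\<close>
    let ?I = "insert i I" and ?a = "a(i := c)"
    have "{F. (\<forall>j\<in>I. F ! j = a j) \<and> (\<forall>(j, c)\<in>set (zip (i # is) (c # cs)). F ! j = c)}
         = {F. (\<forall>j\<in>?I. F ! j = ?a j) \<and> (\<forall>(j, c)\<in>set (zip is cs). F ! j = c)}"
      using False by auto
    moreover have "measure_pmf.prob (replicate_pmf m P) {F. (\<forall>j\<in>?I. F ! j = ?a j) \<and> (\<forall>(j, c)\<in>set (zip is cs). F ! j = c)} = (\<Prod>i\<in>?I. pmf P (?a i)) *
       prod_list (map (\<lambda>(i, c). if i \<in> ?I then of_bool (?a i = c) else pmf P c) (zip is cs))"
      by (rule Cons.IH) (use Cons.prems in auto)
    moreover have "(\<Prod>i\<in>?I. pmf P (?a i)) = pmf P c * (\<Prod>i\<in>I. pmf P (a i))"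
      using False Cons.prems by (auto intro!: prod.cong)
    moreover have "map (\<lambda>(i, c). if i \<in> ?I then of_bool (?a i = c) else pmf P c) (zip is cs) =
       map (\<lambda>(i, c). if i \<in> I then of_bool (a i = c) else pmf P c) (zip is cs)"
      by (rule map_cong) (use Cons.prems in \<open>auto dest: set_zip_leftD\<close>)
    ultimately show ?thesis using False by (simp only: zip_Cons_Cons list.map prod_list.Cons split if_False ac_simps)
  qed
qed

lemma prob_replicate_pmf_positions:
  assumes "length is = length cs" "distinct is" "set is \<subseteq> {..<m}"
  shows "measure_pmf.prob (replicate_pmf m P) {F. \<forall>(i, c)\<in>set (zip is cs). F ! i = c}
     = prod_list (map (pmf P) cs)"
proof -
  have "map (\<lambda>(i, c). pmf P c) (zip is cs) = map (pmf P) cs"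
    using assms(1) by (induction "is" cs rule: list_induct2) auto
  then show ?thesis using prob_replicate_pmf_zip[of "{}" m "is" cs P] assms by simp
qed

lemma sum_lists_Suc:
  assumes "finite V"
  shows "(\<Sum>xs | set xs \<subseteq> V \<and> length xs = Suc k. f xs)
     = (\<Sum>x\<in>V. \<Sum>xs | set xs \<subseteq> V \<and> length xs = k. f (x # xs))"
proof -
  have "{xs. set xs \<subseteq> V \<and> length xs = Suc k} = (\<lambda>(x, xs). x # xs) ` (V \<times> {xs. set xs \<subseteq> V \<and> length xs = k})"
    by (auto simp: length_Suc_conv image_iff)
  moreover have "inj_on (\<lambda>(x, xs). x # xs) (V \<times> {xs. set xs \<subseteq> V \<and> length xs = k})"
    by (auto simp: inj_on_def)
  ultimately show ?thesis
    by (simp add: sum.reindex sum.cartesian_product case_prod_unfold)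
qed

text \<open>Distributive law: each clause chooses its position independently. This turns the count
  of placements of a snake into one factor per clause.\<close>

lemma sum_lists_prod_zip:
  fixes h :: "'a \<Rightarrow> 'b \<Rightarrow> real"
  assumes "finite V"
  shows "(\<Sum>is | set is \<subseteq> V \<and> length is = length cs. prod_list (map (\<lambda>(i, c). h i c) (zip is cs)))
     = prod_list (map (\<lambda>c. \<Sum>i\<in>V. h i c) cs)"
proof (induction cs)
  case Nil
  have "{is :: 'a list. set is \<subseteq> V \<and> length is = 0} = {[]}" by auto
  then show ?case by simp
next
  case (Cons c cs)
  show ?case using assms
    by (simp add: sum_lists_Suc sum_distrib_left[symmetric] Cons.IH sum_distrib_right[symmetric])
qed

fun path_clauses :: "literal \<Rightarrow> literal list \<Rightarrow> literal \<Rightarrow> clause list" where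
  "path_clauses u [] v = [{neg u, v}]"
| "path_clauses u (x # xs) v = {neg u, x} # path_clauses x xs v"

lemma length_path_clauses [simp]: "length (path_clauses u xs v) = Suc (length xs)"
  by (induction xs arbitrary: u) auto

lemma path_clauses_append:
  "path_clauses u (xs @ y # ys) v = path_clauses u xs y @ path_clauses y ys v"
  by (induction xs arbitrary: u) auto

section \<open>Bicycles\<close>

definition implications :: "formula \<Rightarrow> (literal \<times> literal) set" where
  "implications F = {(a, b). {neg a, b} \<in> set F}"

lemma implications_contrapositive:
  "(a, b) \<in> implications F \<Longrightarrow> (neg b, neg a) \<in> implications F"
  by (simp add: implications_def insert_commute)

lemma implications_rtrancl_contrapositive:
  "(a, b) \<in> (implications F)\<^sup>* \<Longrightarrow> (neg b, neg a) \<in> (implications F)\<^sup>*"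
proof (induction rule: rtrancl_induct)
  case (step b c)
  then show ?case by (metis converse_rtrancl_into_rtrancl implications_contrapositive)
qed simp

text \<open>A consistent set of true literals closed under implication is grown variable by
  variable. An undecided variable has a sign \<open>l\<close> that does not lead to its own
  negation; everything reachable from \<open>l\<close> is made true, and contraposition rules out
  conflicts.\<close>

lemma satisfiable_2SAT:
  assumes clauses: "\<And>C. C \<in> set F \<Longrightarrow> \<exists>a b. C = {a, b} \<and> a \<in> lits n \<and> b \<in> lits n"
    and acyc: "\<And>l. \<not> ((l, neg l) \<in> (implications F)\<^sup>* \<and> (neg l, l) \<in> (implications F)\<^sup>*)"
  shows "satisfiable F"
proof -
  let ?E = "implications F"
  have "\<exists>S. (\<forall>l\<in>S. neg l \<notin> S) \<and> (\<forall>a b. (a, b) \<in> ?E \<longrightarrow> a \<in> S \<longrightarrow> b \<in> S) \<and>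
      (\<forall>x<k. \<exists>l\<in>S. fst l = x)" for k
  proof (induction k)
    case 0
    show ?case by (intro exI[of _ "{}"]) simp
  next
    case (Suc k)
    then obtain S where cons: "\<And>l. l \<in> S \<Longrightarrow> neg l \<notin> S"
      and closed: "\<And>a b. (a, b) \<in> ?E \<Longrightarrow> a \<in> S \<Longrightarrow> b \<in> S"
      and dec: "\<And>x. x < k \<Longrightarrow> \<exists>l\<in>S. fst l = x" by metis
    show ?case
    proof (cases "\<exists>l\<in>S. fst l = k")
      case True
      then have "\<forall>x<Suc k. \<exists>l\<in>S. fst l = x" using dec less_Suc_eq by auto
      then show ?thesis using cons closed by blast
    next
      case False
      have "\<exists>l. fst l = k \<and> (l, neg l) \<notin> ?E\<^sup>*"
        using acyc[of "(k, True)"] by (metis fst_conv fst_neg neg_neg)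
      then obtain l where l: "fst l = k" "(l, neg l) \<notin> ?E\<^sup>*" by blast
      then have nl: "neg l \<notin> S" using False by auto
      have closed': "b \<in> S" if "(a, b) \<in> ?E\<^sup>*" "a \<in> S" for a b
        using that by (induction rule: rtrancl_induct) (auto intro: closed)
      let ?S = "S \<union> {b. (l, b) \<in> ?E\<^sup>*}"
      \<comment> \<open>If \<open>l\<close> reached \<open>neg b\<close>, then \<open>b\<close>
        would reach \<open>neg l\<close>, and closure would put \<open>neg l\<close> into
        \<open>S\<close> although its variable is undecided.\<close>
      have c1: "(l, neg b) \<notin> ?E\<^sup>*" if "b \<in> S" for b
        using implications_rtrancl_contrapositive[of l "neg b" F] closed' that nl by (metis neg_neg)
      have c2: "(l, neg b) \<notin> ?E\<^sup>*" if "(l, b) \<in> ?E\<^sup>*" for b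
        using implications_rtrancl_contrapositive[of l "neg b" F] that l(2) by (metis neg_neg rtrancl_trans)
      have "\<forall>a\<in>?S. neg a \<notin> ?S"
        using cons c1 c2 by (metis (no_types, lifting) UnE mem_Collect_eq neg_neg)
      moreover have "\<forall>a b. (a, b) \<in> ?E \<longrightarrow> a \<in> ?S \<longrightarrow> b \<in> ?S"
        using closed by (auto intro: rtrancl_into_rtrancl)
      moreover have "\<forall>x<Suc k. \<exists>l\<in>?S. fst l = x"
        using dec l(1) by (auto simp: less_Suc_eq)
      ultimately show ?thesis by blast
    qed
  qed
  then obtain S where cons: "\<And>l. l \<in> S \<Longrightarrow> neg l \<notin> S"
      and closed: "\<And>a b. (a, b) \<in> ?E \<Longrightarrow> a \<in> S \<Longrightarrow> b \<in> S"
      and dec: "\<And>x. x < n \<Longrightarrow> \<exists>l\<in>S. fst l = x" by metis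
  define \<sigma> where "\<sigma> x = ((x, True) \<in> S)" for x
  have true: "\<sigma> (fst l) = snd l" if "l \<in> S" for l
    using that cons[OF that] by (cases l; cases "snd l") (auto simp: \<sigma>_def neg_def)
  have "\<exists>(x, s)\<in>C. \<sigma> x = s" if C: "C \<in> set F" for C
  proof -
    obtain a b where ab: "C = {a, b}" "a \<in> lits n" using clauses[OF C] by blast
    obtain l where "l \<in> S" "fst l = fst a" using dec ab(2) unfolding mem_lits by blast
    then have "a \<in> S \<or> neg a \<in> S" by (auto simp: same_variable_iff)
    moreover have "(neg a, b) \<in> ?E" using C ab(1) by (simp add: implications_def)
    ultimately have "a \<in> S \<or> b \<in> S" using closed by blast
    then have "\<exists>l\<in>C. \<sigma> (fst l) = snd l" using true ab(1) by blast
    then show ?thesis by (simp add: case_prod_unfold)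
  qed
  then show ?thesis unfolding satisfiable_def satisfies_def by blast
qed

text \<open>A walk is straightened to a path on distinct variables: a repeated literal lets the loop
  be cut out, while reaching the negation of a literal on the path stops the construction and
  supplies the exit of a bicycle.\<close>

lemma forward_branch:
  assumes "(x, y) \<in> R\<^sup>*"
  shows "(\<exists>ws. ws \<noteq> [] \<and> hd ws = x \<and> last ws = y \<and> successively (\<lambda>a b. (a, b) \<in> R) ws
            \<and> distinct (map fst ws))
       \<or> (\<exists>ws v. ws \<noteq> [] \<and> hd ws = x \<and> successively (\<lambda>a b. (a, b) \<in> R) ws
            \<and> distinct (map fst ws) \<and> v \<in> set ws \<and> (last ws, neg v) \<in> R)"
  using assms
proof (induction rule: rtrancl_induct)
  case base
  show ?case by (intro disjI1 exI[of _ "[x]"]) simp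
next
  case (step y z)
  show ?case using step.IH
  proof (elim disjE)
    assume "\<exists>ws. ws \<noteq> [] \<and> hd ws = x \<and> last ws = y \<and> successively (\<lambda>a b. (a, b) \<in> R) ws
            \<and> distinct (map fst ws)"
    then obtain ws where ws: "ws \<noteq> []" "hd ws = x" "last ws = y"
        "successively (\<lambda>a b. (a, b) \<in> R) ws" "distinct (map fst ws)" by blast
    consider "fst z \<notin> fst ` set ws" | "z \<in> set ws" | "neg z \<in> set ws"
      by (metis imageE neg_neg same_variable_iff)
    then show ?case
    proof cases
      case 1
      then show ?thesis using ws step.hyps
        by (intro disjI1 exI[of _ "ws @ [z]"]) (auto simp: successively_append_iff)
    next
      case 2
      then obtain as bs where "ws = as @ z # bs" by (auto simp: in_set_conv_decomp)
      then show ?thesis using ws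
        by (intro disjI1 exI[of _ "as @ [z]"]) (auto simp: successively_append_iff hd_append)
    next
      case 3
      then show ?thesis using ws step.hyps by (intro disjI2 exI[of _ ws] exI[of _ "neg z"]) auto
    qed
  qed blast
qed

text \<open>The path is prolonged backwards along the walk from \<open>y\<close> until a predecessor
  on one of its own variables appears, which must happen because \<open>y\<close> lies on such a
  variable. The exit towards \<open>neg v\<close> survives every prolongation.\<close>

lemma backward_branch:
  assumes "(y, hd ws) \<in> R\<^sup>*" "y \<noteq> hd ws" "fst y \<in> fst ` set ws" "ws \<noteq> []"
    "successively (\<lambda>a b. (a, b) \<in> R) ws" "distinct (map fst ws)" "v \<in> set ws" "(last ws, neg v) \<in> R"
  shows "\<exists>ws u. ws \<noteq> [] \<and> successively (\<lambda>a b. (a, b) \<in> R) ws \<and> distinct (map fst ws)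
       \<and> v \<in> set ws \<and> (last ws, neg v) \<in> R \<and> (u, hd ws) \<in> R \<and> fst u \<in> fst ` set ws"
proof -
  have "\<And>ws. hd ws = z \<Longrightarrow> y \<noteq> hd ws \<Longrightarrow> fst y \<in> fst ` set ws \<Longrightarrow> ws \<noteq> [] \<Longrightarrow>
    successively (\<lambda>a b. (a, b) \<in> R) ws \<Longrightarrow> distinct (map fst ws) \<Longrightarrow> v \<in> set ws \<Longrightarrow> (last ws, neg v) \<in> R \<Longrightarrow>
     \<exists>ws u. ws \<noteq> [] \<and> successively (\<lambda>a b. (a, b) \<in> R) ws \<and> distinct (map fst ws)
       \<and> v \<in> set ws \<and> (last ws, neg v) \<in> R \<and> (u, hd ws) \<in> R \<and> fst u \<in> fst ` set ws"
    if "(y, z) \<in> R\<^sup>*" for z using that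
  proof (induction rule: rtrancl_induct)
    case base
    then show ?case by blast
  next
    case (step z' z)
    show ?case
    proof (cases "fst z' \<in> fst ` set ws")
      case True
      then show ?thesis using step.prems step.hyps by blast
    next
      case False
      then have "y \<noteq> z'" using step.prems by auto
      then show ?thesis using step.prems step.hyps False
        by (intro step.IH[of "z' # ws"]) (auto simp: successively_Cons)
    qed
  qed
  from this[OF assms(1) refl assms(2-)] show ?thesis .
qed

lemma set_path_clauses_subset:
  assumes "ws \<noteq> []" "(u, hd ws) \<in> implications F" "successively (\<lambda>a b. (a, b) \<in> implications F) ws"
    "(last ws, v) \<in> implications F"
  shows "set (path_clauses u ws v) \<subseteq> set F"
  using assms
proof (induction ws arbitrary: u)
  case (Cons w ws)
  have "set (path_clauses w ws v) \<subseteq> set F"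
  proof (cases "ws = []")
    case True
    then show ?thesis using Cons.prems by (simp add: implications_def)
  next
    case False
    then show ?thesis using Cons.prems by (intro Cons.IH) (auto simp: successively_Cons)
  qed
  then show ?case using Cons.prems by (simp add: implications_def)
qed simp

lemma mem_path_clausesD:
  "C \<in> set (path_clauses u ws v) \<Longrightarrow> \<exists>a b. C = {neg a, b} \<and> a \<in> insert u (set ws) \<and> b \<in> insert v (set ws)"
proof (induction ws arbitrary: u)
  case (Cons w ws)
  then consider "C = {neg u, w}" | "C \<in> set (path_clauses w ws v)" by auto
  then show ?case
  proof cases
    case 1
    then show ?thesis by (metis insertI1 insertI2 list.simps(15))
  next
    case 2
    then show ?thesis using Cons.IH[of w] by (metis insertE insertI1 insertI2 list.simps(15))
  qed
qed (metis empty_iff insert_iff list.set path_clauses.simps(1))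

lemma ex_path_clause: "w \<in> set ws \<Longrightarrow> \<exists>a. {a, w} \<in> set (path_clauses u ws v)"
proof (induction ws arbitrary: u)
  case (Cons x ws)
  then show ?case by (cases "w = x") (metis list.set_intros path_clauses.simps(2) set_ConsD)+
qed simp

text \<open>A later clause can contain \<open>w\<close> only as its head or as the negation of its
  tail. Distinct variables exclude both, except for the final head \<open>v\<close>, which is
  excluded by hypothesis.\<close>

lemma distinct_path_clauses:
  assumes "distinct (map fst ws)" "v \<notin> set ws"
  shows "distinct (path_clauses u ws v)"
  using assms
proof (induction ws arbitrary: u)
  case (Cons w ws)
  have "{neg u, w} \<notin> set (path_clauses w ws v)"
  proof
    assume "{neg u, w} \<in> set (path_clauses w ws v)"
    then obtain a b where ab: "{neg u, w} = {neg a, b}" "a \<in> insert w (set ws)" "b \<in> insert v (set ws)"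
      using mem_path_clausesD by blast
    then have "w = b \<or> w = neg a" by (auto simp: doubleton_eq_iff)
    then show False using ab Cons.prems by (auto simp: image_iff)
  qed
  then show ?case using Cons by simp
qed simp

text \<open>A bicycle is a chain of implications through literals \<open>ws\<close> on distinct variables that is
  entered from, and left to, literals on variables of \<open>ws\<close>. The condition \<open>v \<notin> set ws\<close> excludes a
  plain directed cycle, which is satisfiable, and makes the clauses of the bicycle distinct.\<close>

definition bicycles :: "nat \<Rightarrow> nat \<Rightarrow> (literal \<times> literal list \<times> literal) set" where
  "bicycles n s = {(u, ws, v). set ws \<subseteq> lits n \<and> length ws = s \<and> distinct (map fst ws) \<and>
     fst u \<in> fst ` set ws \<and> fst v \<in> fst ` set ws \<and> v \<notin> set ws}"

text \<open>Some \<open>l\<close> and \<open>neg l\<close> reach each other. The walk from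
  \<open>l\<close> to \<open>neg l\<close> cannot become a path on distinct variables, since its
  ends share one, so it provides the exit; the walk from \<open>neg l\<close> to \<open>l\<close>,
  followed backwards, provides the entrance.\<close>

lemma unsatisfiable_imp_bicycle:
  assumes clauses: "\<And>C. C \<in> set F \<Longrightarrow> \<exists>a b. C = {a, b} \<and> a \<in> lits n \<and> b \<in> lits n"
    and "\<not> satisfiable F"
  shows "\<exists>s\<le>n. \<exists>(u, ws, v)\<in>bicycles n s. set (path_clauses u ws v) \<subseteq> set F"
proof -
  let ?E = "implications F"
  obtain l where l: "(l, neg l) \<in> ?E\<^sup>*" "(neg l, l) \<in> ?E\<^sup>*"
    using satisfiable_2SAT[OF clauses] assms(2) by blast
  have "\<exists>ws v. ws \<noteq> [] \<and> hd ws = l \<and> successively (\<lambda>a b. (a, b) \<in> ?E) ws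
            \<and> distinct (map fst ws) \<and> v \<in> set ws \<and> (last ws, neg v) \<in> ?E"
    using forward_branch[OF l(1)]
  proof (elim disjE)
    assume "\<exists>ws. ws \<noteq> [] \<and> hd ws = l \<and> last ws = neg l \<and> successively (\<lambda>a b. (a, b) \<in> ?E) ws
            \<and> distinct (map fst ws)"
    then obtain ws where ws: "ws \<noteq> []" "hd ws = l" "last ws = neg l" "distinct (map fst ws)" by blast
    have "hd ws \<in> set ws" "last ws \<in> set ws" using ws(1) by simp_all
    then have "l = neg l" using ws by (metis distinct_map fst_neg inj_onD)
    then show ?thesis by simp
  qed
  then obtain ws0 v where ws0: "ws0 \<noteq> []" "hd ws0 = l" "successively (\<lambda>a b. (a, b) \<in> ?E) ws0"
      "distinct (map fst ws0)" "v \<in> set ws0" "(last ws0, neg v) \<in> ?E" by blast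
  have "fst (neg l) \<in> fst ` set ws0" using ws0 by force
  then obtain ws u where ws: "ws \<noteq> []" "successively (\<lambda>a b. (a, b) \<in> ?E) ws" "distinct (map fst ws)"
     "v \<in> set ws" "(last ws, neg v) \<in> ?E" "(u, hd ws) \<in> ?E" "fst u \<in> fst ` set ws"
    using backward_branch[of "neg l" ws0 ?E v] ws0 l(2) by (metis neg_neq(1))
  have sub: "set (path_clauses u ws (neg v)) \<subseteq> set F"
    by (rule set_path_clauses_subset) (use ws in auto)
  have "neg v \<notin> set ws" using ws(3,4) by (metis distinct_map fst_neg inj_onD neg_neq(1))
  moreover have "set ws \<subseteq> lits n"
  proof
    fix w assume "w \<in> set ws"
    then obtain a where "{a, w} \<in> set F" using sub ex_path_clause by blast
    then show "w \<in> lits n" using clauses by (metis doubleton_eq_iff)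
  qed
  moreover have "length ws \<le> n"
  proof -
    have "length ws = card (fst ` set ws)" using ws(3) distinct_card[of "map fst ws"] by simp
    also have "\<dots> \<le> card {..<n}"
      by (rule card_mono) (use \<open>set ws \<subseteq> lits n\<close> in \<open>auto simp: mem_lits\<close>)
    finally show ?thesis by simp
  qed
  ultimately have "(u, ws, neg v) \<in> bicycles n (length ws)" "length ws \<le> n"
    using ws by (auto simp: bicycles_def)
  then show ?thesis using sub by blast
qed

section \<open>First moment of bicycles\<close>

lemma finite_card_bicycles:
  "finite (bicycles n s) \<and> card (bicycles n s) \<le> (2 * n) ^ s * (2 * s)\<^sup>2"
proof -
  let ?L = "{ws. set ws \<subseteq> lits n \<and> length ws = s}"
  let ?V = "\<lambda>ws :: literal list. fst ` set ws \<times> (UNIV :: bool set)"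
  let ?T = "SIGMA ws:?L. ?V ws \<times> ?V ws"
  have fin: "finite ?L" by (simp add: finite_lists_length_eq)
  have V: "card (?V ws) \<le> 2 * s" if "ws \<in> ?L" for ws
  proof -
    have "card (fst ` set ws) \<le> s"
      using that card_image_le[of "set ws" fst] card_length[of ws] by auto
    then show ?thesis by (simp add: card_cartesian_product)
  qed
  have sub: "bicycles n s \<subseteq> (\<lambda>(ws, u, v). (u, ws, v)) ` ?T"
    by (fastforce simp: bicycles_def image_iff)
  have finT: "finite ?T" using fin by auto
  have "card (bicycles n s) \<le> card ?T"
    using card_mono[OF finite_imageI[OF finT] sub] card_image_le[OF finT] le_trans by blast
  also have "\<dots> = (\<Sum>ws\<in>?L. card (?V ws) * card (?V ws))"
    by (subst card_SigmaI) (use fin in \<open>auto simp: card_cartesian_product\<close>)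
  also have "\<dots> \<le> (\<Sum>ws\<in>?L. (2 * s)\<^sup>2)"
    unfolding power2_eq_square by (intro sum_mono mult_le_mono V)
  also have "\<dots> = (2 * n) ^ s * (2 * s)\<^sup>2"
    by (simp add: card_lists_length_eq card_lits)
  finally show ?thesis using finite_subset[OF sub] finT by simp
qed

lemma prod_list_path_clauses_le:
  assumes p: "0 < p" "p < 1" and n: "2 \<le> n"
  defines "k \<equiv> 2 / (real n * (real n - 1))"
  shows "prod_list (map (pmf (biased_clause p 2 n)) (path_clauses u ws v))
     \<le> k ^ Suc (length ws) * (p * (1 - p)) ^ length ws * (bias p (neg u) * bias p v)"
proof (induction ws arbitrary: u)
  case Nil
  show ?case using pmf_biased_clause_2_le[OF p n] by (simp add: k_def mult.assoc)
next
  case (Cons w ws)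
  have b: "0 \<le> bias p l" for l using p by (simp add: bias_def)
  have k: "0 \<le> k" using n by (simp add: k_def)
  have nn: "0 \<le> prod_list (map (pmf (biased_clause p 2 n)) (path_clauses w ws v))"
    by (rule prod_list_nonneg) auto
  have "prod_list (map (pmf (biased_clause p 2 n)) (path_clauses u (w # ws) v)) \<le>
    (k * bias p (neg u) * bias p w) * (k ^ Suc (length ws) * (p * (1 - p)) ^ length ws * (bias p (neg w) * bias p v))"
    using mult_mono[OF pmf_biased_clause_2_le[OF p n, of "neg u" w] Cons.IH[of w]] b k nn
    unfolding k_def[symmetric] by simp
  also have "\<dots> = k ^ Suc (length (w # ws)) * ((bias p w * bias p (neg w)) * (p * (1 - p)) ^ length ws) * (bias p (neg u) * bias p v)"
    by simp
  finally show ?case unfolding bias_mult_neg by simp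
qed

lemma distinct_positions:
  assumes "distinct cs" "set cs \<subseteq> set F"
  shows "\<exists>is. length is = length cs \<and> distinct is \<and> set is \<subseteq> {..<length F} \<and> (\<forall>(i, c)\<in>set (zip is cs). F ! i = c)"
  using assms
proof (induction cs)
  case (Cons c cs)
  then obtain "is" where IH: "length is = length cs" "distinct is" "set is \<subseteq> {..<length F}"
    "\<forall>(i, c)\<in>set (zip is cs). F ! i = c" by auto
  obtain i where i: "i < length F" "F ! i = c" using Cons.prems by (auto simp: in_set_conv_nth)
  have "i \<notin> set is"
  proof
    assume "i \<in> set is"
    then obtain c' where "(i, c') \<in> set (zip is cs)" using IH(1) by (metis in_set_impl_in_set_zip1)
    then have "c' = c" "c' \<in> set cs" using IH(4) i by (auto dest: set_zip_rightD)
    then show False using Cons.prems by simp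
  qed
  then show ?case using IH i by (intro exI[of _ "i # is"]) auto
qed simp

text \<open>Union bound over bicycles and their positions. With s variables there are s + 1 clauses,
  hence one factor \<open>real m * k\<close> besides the s-th power; for m linear in n this surplus
  clause makes the bound O(1 / n).\<close>

lemma prob_unsatisfiable_le:
  assumes p: "0 < p" "p < 1" and n: "2 \<le> n"
  defines "k \<equiv> 2 / (real n * (real n - 1))"
  shows "measure_pmf.prob (biased_formula p 2 m n) {F. \<not> satisfiable F}
    \<le> real m * k * (\<Sum>s\<le>n. 4 * (real s)\<^sup>2 * (2 * real n * (real m * k) * (p * (1 - p))) ^ s)"
proof -
  let ?M = "biased_formula p 2 m n"
  let ?P = "biased_clause p 2 n"
  let ?pos = "\<lambda>s. {is. set is \<subseteq> {..<m} \<and> length is = Suc s}"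
  \<comment> \<open>Position lists with repetitions get the empty event, so the union runs over all
    lists although the product formula needs distinct ones.\<close>
  let ?ev = "\<lambda>(u, ws, v) is. if distinct is then {F. \<forall>(i, c)\<in>set (zip is (path_clauses u ws v)). F ! i = c} else {}"
  have k: "0 \<le> k" using n by (simp add: k_def)
  have finp: "finite (?pos s)" for s by (simp add: finite_lists_length_eq)
  have "measure_pmf.prob ?M {F. \<not> satisfiable F} = measure_pmf.prob ?M ({F. \<not> satisfiable F} \<inter> set_pmf ?M)"
    by (rule measure_Int_set_pmf[symmetric])
  also have "\<dots> \<le> measure_pmf.prob ?M (\<Union>s\<in>{..n}. \<Union>t\<in>bicycles n s. \<Union>is\<in>?pos s. ?ev t is)"
  proof (rule measure_pmf.finite_measure_mono)
    show "{F. \<not> satisfiable F} \<inter> set_pmf ?M \<subseteq> (\<Union>s\<in>{..n}. \<Union>t\<in>bicycles n s. \<Union>is\<in>?pos s. ?ev t is)"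
    proof
      fix F assume F: "F \<in> {F. \<not> satisfiable F} \<inter> set_pmf ?M"
      then have len: "length F = m" and "set F \<subseteq> set_pmf ?P"
        using set_replicate_pmf_lists[of F m ?P] by (auto simp: biased_formula_def)
      then have "\<And>C. C \<in> set F \<Longrightarrow> \<exists>a b. C = {a, b} \<and> a \<in> lits n \<and> b \<in> lits n"
        using biased_clause_2_support[OF n] by blast
      then obtain s u ws v where s: "s \<le> n" and t: "(u, ws, v) \<in> bicycles n s"
        and sub: "set (path_clauses u ws v) \<subseteq> set F"
        using unsatisfiable_imp_bicycle[of F n] F by fast
      have "distinct (path_clauses u ws v)"
        by (rule distinct_path_clauses) (use t in \<open>auto simp: bicycles_def\<close>)
      then obtain "is" where "is": "length is = length (path_clauses u ws v)" "distinct is" "set is \<subseteq> {..<m}"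
        "\<forall>(i, c)\<in>set (zip is (path_clauses u ws v)). F ! i = c"
        using distinct_positions[OF _ sub] len by blast
      have "F \<in> ?ev (u, ws, v) is" using "is" by simp
      moreover have "is \<in> ?pos s" using "is" t by (auto simp: bicycles_def)
      ultimately show "F \<in> (\<Union>s\<in>{..n}. \<Union>t\<in>bicycles n s. \<Union>is\<in>?pos s. ?ev t is)" using s t by blast
    qed
  qed simp
  also have "\<dots> \<le> (\<Sum>s\<le>n. \<Sum>t\<in>bicycles n s. \<Sum>is\<in>?pos s. measure_pmf.prob ?M (?ev t is))"
    by (intro order_trans[OF measure_pmf.finite_measure_subadditive_finite] sum_mono order_refl)
       (auto simp: finite_card_bicycles finp)
  also have "\<dots> \<le> (\<Sum>s\<le>n. \<Sum>t\<in>bicycles n s. \<Sum>is\<in>?pos s. k ^ Suc s * (p * (1 - p)) ^ s)"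
  proof (intro sum_mono)
    fix s t "is" assume t: "t \<in> bicycles n s" and "is": "is \<in> ?pos s"
    obtain u ws v where tt: "t = (u, ws, v)" by (cases t)
    have len: "length ws = s" using t tt by (auto simp: bicycles_def)
    show "measure_pmf.prob ?M (?ev t is) \<le> k ^ Suc s * (p * (1 - p)) ^ s"
    proof (cases "distinct is")
      case True
      have "measure_pmf.prob ?M (?ev t is) = prod_list (map (pmf ?P) (path_clauses u ws v))"
        unfolding biased_formula_def tt using True "is" len
        by (simp add: prob_replicate_pmf_positions)
      also have "\<dots> \<le> k ^ Suc s * (p * (1 - p)) ^ s * (bias p (neg u) * bias p v)"
        using prod_list_path_clauses_le[OF p n, of u ws v] len unfolding k_def by simp
      also have "\<dots> \<le> k ^ Suc s * (p * (1 - p)) ^ s"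
        using p k by (intro mult_right_le_one_le mult_le_one) (auto simp: bias_def)
      finally show ?thesis .
    qed (use p k tt in auto)
  qed
  also have "\<dots> = (\<Sum>s\<le>n. real (card (bicycles n s)) * real (card (?pos s)) * (k ^ Suc s * (p * (1 - p)) ^ s))"
    by (simp add: mult.assoc)
  also have "\<dots> \<le> (\<Sum>s\<le>n. real ((2 * n) ^ s * (2 * s)\<^sup>2) * real (m ^ Suc s) * (k ^ Suc s * (p * (1 - p)) ^ s))"
  proof (intro sum_mono mult_right_mono mult_mono)
    fix s
    show "real (card (bicycles n s)) \<le> real ((2 * n) ^ s * (2 * s)\<^sup>2)"
      using finite_card_bicycles of_nat_le_iff by blast
    show "real (card (?pos s)) \<le> real (m ^ Suc s)"
      by (simp add: card_lists_length_eq del: power_Suc)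
  qed (use p k in auto)
  also have "\<dots> = real m * k * (\<Sum>s\<le>n. 4 * (real s)\<^sup>2 * (2 * real n * (real m * k) * (p * (1 - p))) ^ s)"
    unfolding sum_distrib_left
    by (intro sum.cong refl) (simp add: power_mult_distrib power2_eq_square del: mult_1)
  finally show ?thesis .
qed

section \<open>Snakes and walk sums\<close>

lemma implied_along_path:
  assumes "satisfies \<sigma> F" "set (path_clauses u ws v) \<subseteq> set F" "\<sigma> (fst u) = snd u"
  shows "\<sigma> (fst v) = snd v"
proof -
  have step: "\<sigma> (fst b) = snd b" if "{neg a, b} \<in> set F" "\<sigma> (fst a) = snd a" for a b
  proof -
    have "\<exists>l\<in>{neg a, b}. \<sigma> (fst l) = snd l"
      using assms(1) that(1) unfolding satisfies_def case_prod_unfold by blast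
    then show ?thesis using that(2) by (auto simp: neg_def)
  qed
  show ?thesis using assms(2,3)
  proof (induction ws arbitrary: u)
    case Nil
    then show ?case using step by simp
  next
    case (Cons w ws)
    then have "\<sigma> (fst w) = snd w" using step[of u w] by simp
    moreover have "set (path_clauses w ws v) \<subseteq> set F" using Cons.prems by simp
    ultimately show ?case by (rule Cons.IH[rotated])
  qed
qed

text \<open>Cut at \<open>y\<close>, the chain leads from \<open>neg y\<close> to \<open>y\<close>
  and back, so no value of its variable is possible.\<close>

lemma snake_unsatisfiable:
  assumes "set (path_clauses (neg y) (us @ y # vs) (neg y)) \<subseteq> set F"
  shows "\<not> satisfiable F"
proof
  assume "satisfiable F"
  then obtain \<sigma> where \<sigma>: "satisfies \<sigma> F" by (auto simp: satisfiable_def)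
  have "set (path_clauses (neg y) us y) \<subseteq> set F" "set (path_clauses y vs (neg y)) \<subseteq> set F"
    using assms by (simp_all add: path_clauses_append)
  then have "\<sigma> (fst y) = snd y \<longleftrightarrow> \<sigma> (fst (neg y)) = snd (neg y)"
    using implied_along_path[OF \<sigma>] by blast
  then show False by (auto simp: neg_def)
qed

section \<open>The second moment method\<close>

text \<open>With X the number of events that occur, (1 - X/Q)^2 >= 0 shows that 2X/Q - (X/Q)^2 is at
  most the indicator of X > 0. The correlation hypothesis says E X^2 <= Q E X, so integrating gives
  E X / Q.\<close>

lemma second_moment_bound:
  fixes M :: "'a pmf" and Ev :: "'b \<Rightarrow> 'a set"
  assumes fin: "finite J" and Q: "0 < Q"
    and corr: "\<And>i. i \<in> J \<Longrightarrow> (\<Sum>j\<in>J. measure_pmf.prob M (Ev i \<inter> Ev j)) \<le> Q * measure_pmf.prob M (Ev i)"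
  shows "(\<Sum>j\<in>J. measure_pmf.prob M (Ev j)) / Q \<le> measure_pmf.prob M (\<Union>j\<in>J. Ev j)"
proof -
  define X where "X = (\<lambda>\<omega>. \<Sum>j\<in>J. indicator (Ev j) \<omega> :: real)"
  define S where "S = (\<Sum>j\<in>J. measure_pmf.prob M (Ev j))"
  have X2: "X \<omega> * X \<omega> = (\<Sum>i\<in>J. \<Sum>j\<in>J. indicator (Ev i \<inter> Ev j) \<omega>)" for \<omega>
    unfolding X_def sum_product by (simp add: indicator_inter_arith)
  have ind: "integrable (measure_pmf M) (indicator B :: 'a \<Rightarrow> real)" for B
    by (simp add: integrable_indicator_iff less_top[symmetric])
  have int1: "integrable (measure_pmf M) X"
    unfolding X_def by (intro Bochner_Integration.integrable_sum ind)
  have int2: "integrable (measure_pmf M) (\<lambda>\<omega>. X \<omega> * X \<omega>)"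
    unfolding X2 by (intro Bochner_Integration.integrable_sum ind)
  have EX: "measure_pmf.expectation M X = S"
    unfolding X_def S_def by (simp add: Bochner_Integration.integral_sum ind)
  have "measure_pmf.expectation M (\<lambda>\<omega>. X \<omega> * X \<omega>) = (\<Sum>i\<in>J. \<Sum>j\<in>J. measure_pmf.prob M (Ev i \<inter> Ev j))"
    unfolding X2
    by (simp add: Bochner_Integration.integral_sum Bochner_Integration.integrable_sum ind)
  also have "\<dots> \<le> (\<Sum>i\<in>J. Q * measure_pmf.prob M (Ev i))" by (intro sum_mono corr)
  also have "\<dots> = Q * S" by (simp add: S_def sum_distrib_left)
  finally have EX2: "measure_pmf.expectation M (\<lambda>\<omega>. X \<omega> * X \<omega>) \<le> Q * S" .
  have pt: "2 / Q * X \<omega> - 1 / (Q * Q) * (X \<omega> * X \<omega>) \<le> indicator (\<Union>j\<in>J. Ev j) \<omega>" for \<omega>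
  proof (cases "\<omega> \<in> (\<Union>j\<in>J. Ev j)")
    case True
    have "0 \<le> (1 - X \<omega> / Q)\<^sup>2" by simp
    then have "2 / Q * X \<omega> - 1 / (Q * Q) * (X \<omega> * X \<omega>) \<le> 1"
      using Q by (simp add: power2_eq_square field_simps)
    then show ?thesis using True by simp
  next
    case False
    then have "X \<omega> = 0" unfolding X_def by (intro sum.neutral) auto
    then show ?thesis by simp
  qed
  have "2 / Q * S - 1 / (Q * Q) * (Q * S) \<le> 2 / Q * S - 1 / (Q * Q) * measure_pmf.expectation M (\<lambda>\<omega>. X \<omega> * X \<omega>)"
    using EX2 Q by (intro diff_left_mono mult_left_mono) auto
  also have "\<dots> = measure_pmf.expectation M (\<lambda>\<omega>. 2 / Q * X \<omega> - 1 / (Q * Q) * (X \<omega> * X \<omega>))"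
    using int1 int2 by (simp add: EX)
  also have "\<dots> \<le> measure_pmf.expectation M (indicator (\<Union>j\<in>J. Ev j))"
    using int1 int2 by (intro integral_mono pt ind) auto
  also have "\<dots> = measure_pmf.prob M (\<Union>j\<in>J. Ev j)" by simp
  finally show ?thesis using Q by (simp add: S_def field_simps)
qed

section \<open>Walk sums of a perturbed rank-one kernel\<close>

text \<open>The (u, v) entry of the matrix power K^(k+1): \<open>k\<close> counts inner vertices,
  which range over \<open>V\<close>, so a walk has k + 1 steps.\<close>

fun walk_sum :: "('a \<Rightarrow> 'a \<Rightarrow> real) \<Rightarrow> 'a set \<Rightarrow> nat \<Rightarrow> 'a \<Rightarrow> 'a \<Rightarrow> real" where
  "walk_sum K V 0 u v = K u v"
| "walk_sum K V (Suc k) u v = (\<Sum>x\<in>V. K u x * walk_sum K V k x v)"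

lemma walk_sum_nonneg:
  assumes "\<And>u v. 0 \<le> K u v"
  shows "0 \<le> walk_sum K V k u v"
  by (induction k arbitrary: u) (auto intro!: sum_nonneg mult_nonneg_nonneg assms)

lemma walk_sum_mono:
  assumes "\<And>u v. 0 \<le> K u v" "\<And>u v. K u v \<le> K' u v"
  shows "walk_sum K V k u v \<le> walk_sum K' V k u v"
proof (induction k arbitrary: u)
  case (Suc k)
  have "0 \<le> K' u x" for x using assms order_trans by blast
  then show ?case
    by (auto intro!: sum_mono mult_mono Suc.IH assms walk_sum_nonneg)
qed (use assms in simp)

lemma sum_path_clauses_eq_walk_sum:
  fixes g :: "clause \<Rightarrow> real"
  assumes "finite V"
  shows "(\<Sum>ws | set ws \<subseteq> V \<and> length ws = k. prod_list (map g (path_clauses u ws v)))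
    = walk_sum (\<lambda>a b. g {neg a, b}) V k u v"
proof (induction k arbitrary: u)
  case 0
  have "{ws :: literal list. set ws \<subseteq> V \<and> length ws = 0} = {[]}" by auto
  then show ?case by simp
next
  case (Suc k)
  show ?case using assms by (simp add: sum_lists_Suc sum_distrib_left[symmetric] Suc.IH)
qed

text \<open>The kernel \<open>K\<close> is a rank-one part, contributed by clauses at fresh positions, plus the part
  \<open>M\<close> that follows implications of a given snake with literal set \<open>A\<close>. The function \<open>\<phi>\<close> is a
  supersolution for \<open>M\<close>, and \<open>b + c \<phi>\<close> is one for \<open>K\<close>.\<close>

locale perturbed_kernel =
  fixes V A :: "'a set" and a b \<phi> :: "'a \<Rightarrow> real" and M :: "'a \<Rightarrow> 'a \<Rightarrow> real"
    and \<kappa> \<mu> \<theta> c N :: real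
  assumes fin: "finite V"
    and a: "\<And>v. 0 \<le> a v" "\<And>v. a v \<le> 1"
    and b: "\<And>v. 0 \<le> b v" "\<And>v. b v \<le> 1"
    and phi: "\<And>v. 0 \<le> \<phi> v" "\<And>v. v \<in> A \<Longrightarrow> 1 / 2 \<le> \<phi> v"
    and M: "\<And>u v. 0 \<le> M u v" "\<And>u v. v \<notin> A \<Longrightarrow> M u v = 0"
    and M_phi: "\<And>u. (\<Sum>v\<in>V. M u v * \<phi> v) \<le> \<mu> * \<phi> u"
    and a_phi: "(\<Sum>v\<in>V. a v * \<phi> v) \<le> N"
    and const: "0 \<le> \<kappa>" "0 \<le> \<mu>" "0 \<le> c" "\<mu> \<le> \<theta>" "\<mu> * (2 + c) \<le> \<theta> * c"
    and theta: "\<theta> = \<kappa> * ((\<Sum>v\<in>V. a v * b v) + c * N)"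
begin

definition "K u v = \<kappa> * b u * a v + M u v"

abbreviation "\<psi> u \<equiv> b u + c * \<phi> u"

lemma N_nonneg: "0 \<le> N"
  using a_phi sum_nonneg[of V "\<lambda>v. a v * \<phi> v"] a phi by (smt (verit) mult_nonneg_nonneg)

lemma K_apply: "(\<Sum>v\<in>V. K u v * f v) = \<kappa> * b u * (\<Sum>v\<in>V. a v * f v) + (\<Sum>v\<in>V. M u v * f v)"
  unfolding K_def by (simp add: distrib_right sum.distrib sum_distrib_left mult.assoc)

lemma K_nonneg: "0 \<le> K u v"
  unfolding K_def using const a b M by simp

text \<open>The rank-one part sees \<open>\<phi>\<close> only through its pairing with
  \<open>a\<close>, so \<open>\<phi>\<close> keeps the small growth rate \<open>\<mu>\<close> up to
  a defect along \<open>b\<close>.\<close>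

lemma K_phi: "(\<Sum>v\<in>V. K u v * \<phi> v) \<le> \<mu> * \<phi> u + \<kappa> * N * b u"
proof -
  have "\<kappa> * b u * (\<Sum>v\<in>V. a v * \<phi> v) \<le> \<kappa> * b u * N"
    using const b by (intro mult_left_mono a_phi) auto
  then show ?thesis unfolding K_apply using M_phi[of u] by (simp add: mult_ac)
qed

text \<open>The rank-one part returns a multiple of \<open>b\<close>, and \<open>\<theta>\<close> is
  defined as its coefficient. Steps of \<open>M\<close> end in \<open>A\<close>, where b \<le> 1
  \<le> 2 \<phi>, so \<open>M\<close> applied to \<open>b\<close> is bounded by
  \<open>\<phi>\<close>, and \<open>\<mu> * (2 + c) \<le> \<theta> * c\<close> lets the share
  \<open>c * \<phi>\<close> absorb it.\<close>

lemma K_psi: "(\<Sum>v\<in>V. K u v * \<psi> v) \<le> \<theta> * \<psi> u"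
proof -
  have "(\<Sum>v\<in>V. M u v * b v) \<le> (\<Sum>v\<in>V. 2 * (M u v * \<phi> v))"
  proof (rule sum_mono)
    fix v
    show "M u v * b v \<le> 2 * (M u v * \<phi> v)"
    proof (cases "v \<in> A")
      case True
      then have "b v \<le> 2 * \<phi> v" using phi(2)[of v] b(2)[of v] by linarith
      then show ?thesis using M(1)[of u v] mult_left_mono[of "b v" "2 * \<phi> v" "M u v"] by simp
    qed (simp add: M)
  qed
  also have "\<dots> \<le> 2 * (\<mu> * \<phi> u)" using M_phi[of u] by (simp add: sum_distrib_left[symmetric])
  finally have Mb: "(\<Sum>v\<in>V. M u v * b v) \<le> 2 * (\<mu> * \<phi> u)" .
  have "(\<Sum>v\<in>V. M u v * \<psi> v) = (\<Sum>v\<in>V. M u v * b v) + c * (\<Sum>v\<in>V. M u v * \<phi> v)"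
    by (simp add: distrib_left sum.distrib sum_distrib_left mult_ac)
  also have "\<dots> \<le> 2 * (\<mu> * \<phi> u) + c * (\<mu> * \<phi> u)"
    using Mb M_phi[of u] const by (intro add_mono mult_left_mono) auto
  also have "\<dots> = \<mu> * (2 + c) * \<phi> u" by (simp add: algebra_simps)
  also have "\<dots> \<le> \<theta> * c * \<phi> u" using const phi by (intro mult_right_mono) auto
  finally have 1: "(\<Sum>v\<in>V. M u v * \<psi> v) \<le> \<theta> * c * \<phi> u" .
  have "(\<Sum>v\<in>V. a v * \<psi> v) = (\<Sum>v\<in>V. a v * b v) + c * (\<Sum>v\<in>V. a v * \<phi> v)"
    by (simp add: distrib_left sum.distrib sum_distrib_left mult_ac)
  also have "\<dots> \<le> (\<Sum>v\<in>V. a v * b v) + c * N" using a_phi const by (intro add_mono mult_left_mono) auto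
  finally have "\<kappa> * b u * (\<Sum>v\<in>V. a v * \<psi> v) \<le> \<kappa> * b u * ((\<Sum>v\<in>V. a v * b v) + c * N)"
    using const b by (intro mult_left_mono) auto
  also have "\<dots> = \<theta> * b u" unfolding theta by simp
  finally show ?thesis unfolding K_apply using 1 by (simp add: algebra_simps)
qed

lemma theta_nonneg: "0 \<le> \<theta>" using const by linarith

text \<open>The last step into a point off \<open>A\<close> must be a rank-one step, which starts
  the induction with \<open>b \<le> \<psi>\<close>; each earlier step costs a factor
  \<open>\<theta>\<close>.\<close>

lemma walk_sum_outside:
  assumes "v \<notin> A"
  shows "walk_sum K V k u v \<le> \<kappa> * a v * \<theta> ^ k * \<psi> u"
proof (induction k arbitrary: u)
  case 0
  have "\<kappa> * a v * b u \<le> \<kappa> * a v * \<psi> u" using const a phi by (intro mult_left_mono) auto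
  then show ?case using M(2)[OF assms] by (simp add: K_def mult_ac)
next
  case (Suc k)
  have "walk_sum K V (Suc k) u v \<le> (\<Sum>x\<in>V. K u x * (\<kappa> * a v * \<theta> ^ k * \<psi> x))"
    by (auto intro!: sum_mono mult_left_mono Suc.IH K_nonneg)
  also have "\<dots> = \<kappa> * a v * \<theta> ^ k * (\<Sum>x\<in>V. K u x * \<psi> x)" by (simp add: sum_distrib_left mult_ac)
  also have "\<dots> \<le> \<kappa> * a v * \<theta> ^ k * (\<theta> * \<psi> u)"
    using const a theta_nonneg by (intro mult_left_mono K_psi) auto
  finally show ?case by (simp add: mult_ac)
qed

text \<open>The last step may now follow \<open>M\<close>. Such walks are tracked by the term in
  \<open>\<phi>\<close>, which grows by \<open>\<mu>\<close> only; by \<open>K_phi\<close> each step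
  moves a defect proportional to \<open>N\<close> into the \<open>\<theta>\<close> term, hence the
  factor linear in \<open>k\<close>.\<close>

lemma walk_sum_inside:
  assumes "v \<in> A" "v \<in> V"
  shows "walk_sum K V k u v \<le> 2 * \<mu> ^ Suc k * \<phi> u + \<kappa> * (1 + 2 * N * real k) * \<theta> ^ k * \<psi> u"
proof (induction k arbitrary: u)
  case 0
  have "M u v \<le> 2 * (M u v * \<phi> v)"
    using mult_left_mono[OF phi(2)[OF assms(1)] M(1)[of u v]] by simp
  also have "M u v * \<phi> v \<le> (\<Sum>v\<in>V. M u v * \<phi> v)"
    using M phi by (intro member_le_sum assms fin) auto
  also note M_phi[of u]
  finally have 1: "M u v \<le> 2 * (\<mu> * \<phi> u)" by simp
  have "b u * a v \<le> b u * 1" by (intro mult_left_mono a b)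
  also have "\<dots> \<le> \<psi> u" using const phi by simp
  finally have "\<kappa> * (b u * a v) \<le> \<kappa> * \<psi> u" using const by (intro mult_left_mono) auto
  then show ?case using 1 by (simp add: K_def mult_ac)
next
  case (Suc k)
  let ?g = "\<kappa> * (1 + 2 * N * real k) * \<theta> ^ k"
  have g: "0 \<le> ?g" using const N_nonneg theta_nonneg by simp
  have "walk_sum K V (Suc k) u v \<le> (\<Sum>x\<in>V. K u x * (2 * \<mu> ^ Suc k * \<phi> x + ?g * \<psi> x))"
    by (simp only: walk_sum.simps, intro sum_mono mult_left_mono Suc.IH K_nonneg)
  also have "\<dots> = 2 * \<mu> ^ Suc k * (\<Sum>x\<in>V. K u x * \<phi> x) + ?g * (\<Sum>x\<in>V. K u x * \<psi> x)"
    unfolding sum_distrib_left sum.distrib[symmetric] by (intro sum.cong refl) (simp add: algebra_simps)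
  also have "\<dots> \<le> 2 * \<mu> ^ Suc k * (\<mu> * \<phi> u + \<kappa> * N * b u) + ?g * (\<theta> * \<psi> u)"
    using const g by (intro add_mono mult_left_mono K_phi K_psi) auto
  also have "\<dots> = 2 * \<mu> ^ Suc (Suc k) * \<phi> u + \<kappa> * (2 * N) * (\<mu> ^ Suc k * b u) + \<kappa> * (1 + 2 * N * real k) * \<theta> ^ Suc k * \<psi> u"
    by (simp add: algebra_simps)
  also have "\<dots> \<le> 2 * \<mu> ^ Suc (Suc k) * \<phi> u + \<kappa> * (2 * N) * (\<theta> ^ Suc k * \<psi> u) + \<kappa> * (1 + 2 * N * real k) * \<theta> ^ Suc k * \<psi> u"
  proof -
    have "\<mu> ^ Suc k * b u \<le> \<theta> ^ Suc k * \<psi> u"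
      using const b phi theta_nonneg by (intro mult_mono power_mono) auto
    then show ?thesis using const N_nonneg by (intro add_mono mult_left_mono order_refl) auto
  qed
  also have "\<dots> = 2 * \<mu> ^ Suc (Suc k) * \<phi> u + \<kappa> * (1 + 2 * N * real (Suc k)) * \<theta> ^ Suc k * \<psi> u"
    by (simp add: algebra_simps)
  finally show ?case .
qed

end

section \<open>An eigenfunction on the implications of a snake\<close>

lemma path_clauses_nth:
  "k \<le> length ws \<Longrightarrow> path_clauses u ws v ! k = {neg ((u # ws @ [v]) ! k), (u # ws @ [v]) ! Suc k}"
proof (induction ws arbitrary: u k)
  case (Cons w ws)
  then show ?case by (cases k) simp_all
qed simp

text \<open>A walk along the implications of a snake has two continuations at the branching literals
  \<open>w t\<close> and \<open>neg (w t)\<close>, and these are \<open>t\<close> steps apart; all other steps are forced. Letting \<open>\<phi>\<close> decay like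
  \<open>2 powr (- d / t)\<close> in the distance \<open>d\<close> to the next branching literal makes it an eigenfunction.\<close>

lemma snake_eigenfunction:
  fixes w :: "nat \<Rightarrow> literal"
  assumes t: "1 \<le> t" and w0: "w 0 = neg (w t)" and w2: "w (2 * t) = neg (w t)"
    and inj: "inj_on (\<lambda>j. fst (w j)) {1..<2 * t}"
  shows "\<exists>\<phi> :: literal \<Rightarrow> real. (\<forall>u. fst u \<in> (\<lambda>j. fst (w j)) ` {1..<2 * t} \<longrightarrow> 1 / 2 \<le> \<phi> u \<and> \<phi> u \<le> 1) \<and>
    (\<forall>u. fst u \<notin> (\<lambda>j. fst (w j)) ` {1..<2 * t} \<longrightarrow> \<phi> u = 0) \<and>
    (\<forall>u. (\<Sum>k<2*t. (if u = w k then \<phi> (w (Suc k)) else 0)) +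
         (\<Sum>k<2*t. (if u = neg (w (Suc k)) then \<phi> (neg (w k)) else 0)) \<le> 2 powr (1 / t) * \<phi> u)"
proof -
  let ?vars = "(\<lambda>j. fst (w j)) ` {1..<2 * t}"
  define h where "h i = (2::real) powr (- real i / t)" for i :: nat
  define idx where "idx u = (THE j. j \<in> {1..<2 * t} \<and> fst (w j) = fst u)" for u :: literal
  \<comment> \<open>From \<open>w j\<close> the walk runs forwards to \<open>w t\<close> or
    \<open>w (2 * t)\<close>, from \<open>neg (w j)\<close> backwards to \<open>neg (w t)\<close> or
    \<open>neg (w 0) = w t\<close>. The two residues are the distances to these branching
    literals.\<close>
  define \<phi> where "\<phi> u = (if fst u \<notin> ?vars then 0
     else if u = w (idx u) then h ((2 * t - idx u) mod t) else h (idx u mod t))" for u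
  let ?\<mu> = "(2::real) powr (1 / t)"
  have idx: "idx u = j" if "j \<in> {1..<2 * t}" "fst (w j) = fst u" for u j
    unfolding idx_def
  proof (rule the_equality)
    fix i assume "i \<in> {1..<2 * t} \<and> fst (w i) = fst u"
    then show "i = j" using that inj_onD[OF inj, of i j] by simp
  qed (use that in simp)
  have hS: "?\<mu> * h (Suc i) = h i" for i
    unfolding h_def powr_add[symmetric] using t by (simp add: field_simps)
  have h0: "h 0 = 1" by (simp add: h_def)
  \<comment> \<open>A branching literal has two successors, each t - 1 steps before the next
    branching. That their values add up to \<open>?\<mu>\<close> times 1 is what fixes the rate
    \<open>2 powr (1 / t)\<close>.\<close>
  have ht: "2 * h (t - 1) = ?\<mu>"
  proof -
    have "?\<mu> * h (Suc (t - 1)) = h (t - 1)" by (rule hS)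
    moreover have "h (Suc (t - 1)) = 1 / 2" using t by (simp add: h_def powr_minus)
    ultimately have "?\<mu> * (1 / 2) = h (t - 1)" by (simp only:)
    then show ?thesis by linarith
  qed
  have h_le: "h i \<le> 1" for i using powr_mono[of "- real i / t" 0 2] by (simp add: h_def)
  have h_ge: "1 / 2 \<le> h (i mod t)" for i
  proof -
    have "real (i mod t) \<le> real t" using t by (simp add: less_imp_le)
    then have "- 1 \<le> - real (i mod t) / t" using t by (simp add: field_simps)
    then have "2 powr (- 1) \<le> h (i mod t)" unfolding h_def by (intro powr_mono) auto
    then show ?thesis by (simp add: powr_minus)
  qed
  have mod0: "2 * t mod t = 0" "(2 * t - t) mod t = 0" by simp_all
  have phi_w: "\<phi> (w j) = h ((2 * t - j) mod t)" if le: "j \<le> 2 * t" for j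
  proof -
    consider "j = 0" | "j = 2 * t" | "j \<in> {1..<2 * t}" using le by force
    then show ?thesis
    proof cases
      case 1
      have tt: "t \<in> {1..<2 * t}" using t by simp
      then have "fst (neg (w t)) \<in> ?vars" by simp
      then show ?thesis using 1 idx[OF tt, of "neg (w t)"] w0 by (simp add: \<phi>_def)
    next
      case 2
      have tt: "t \<in> {1..<2 * t}" using t by simp
      then have "fst (neg (w t)) \<in> ?vars" by simp
      then show ?thesis using 2 idx[OF tt, of "neg (w t)"] w2 by (simp add: \<phi>_def)
    next
      case 3
      then have "fst (w j) \<in> ?vars" by blast
      then show ?thesis using 3 idx[of j "w j"] by (simp add: \<phi>_def)
    qed
  qed
  have phi_neg: "\<phi> (neg (w j)) = h (j mod t)" if le: "j \<le> 2 * t" for j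
  proof -
    consider "j = 0" | "j = 2 * t" | "j \<in> {1..<2 * t}" using le by force
    then show ?thesis
    proof cases
      case 1
      then have "neg (w j) = w t" using w0 by simp
      then show ?thesis using 1 phi_w[of t] by simp
    next
      case 2
      then have "neg (w j) = w t" using w2 by simp
      then show ?thesis using 2 phi_w[of t] by simp
    next
      case 3
      then have "fst (neg (w j)) \<in> ?vars" by simp
      then show ?thesis using 3 idx[of j "neg (w j)"] by (simp add: \<phi>_def)
    qed
  qed
  \<comment> \<open>The only coincidence of variables: both ends \<open>w 0\<close> and
    \<open>w (2 * t)\<close> lie on the variable of \<open>w t\<close>.\<close>
  have var: "k = i \<or> (i = t \<and> (k = 0 \<or> k = 2 * t))"
    if "i \<in> {1..<2 * t}" and le: "k \<le> 2 * t" and "fst (w k) = fst (w i)" for i k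
  proof -
    have tt: "t \<in> {1..<2 * t}" using t by simp
    consider "k = 0" | "k = 2 * t" | "k \<in> {1..<2 * t}" using le by force
    then show ?thesis
    proof cases
      case 1
      then have "fst (w t) = fst (w i)" using w0 that by simp
      then show ?thesis using 1 inj_onD[OF inj _ tt that(1)] by simp
    next
      case 2
      then have "fst (w t) = fst (w i)" using w2 that by simp
      then show ?thesis using 2 inj_onD[OF inj _ tt that(1)] by simp
    next
      case 3
      then show ?thesis using inj_onD[OF inj that(3) 3 that(1)] by simp
    qed
  qed
  \<comment> \<open>\<open>S u\<close> and \<open>T u\<close> index the implications leaving
    \<open>u\<close>, read forwards and by contraposition.\<close>
  define S where "S u = {k \<in> {..<2*t}. u = w k}" for u
  define T where "T u = {k \<in> {..<2*t}. u = neg (w (Suc k))}" for u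
  have "(\<Sum>k\<in>S u. \<phi> (w (Suc k))) + (\<Sum>k\<in>T u. \<phi> (neg (w k))) \<le> ?\<mu> * \<phi> u" for u
  proof (cases "fst u \<in> ?vars")
    case False
    have tt: "t \<in> {1..<2 * t}" using t by simp
    have "fst (w k) \<in> ?vars" if le: "k \<le> 2 * t" for k
    proof -
      consider "k = 0" | "k = 2 * t" | "k \<in> {1..<2 * t}" using le by force
      then show ?thesis
      proof cases
        case 1
        then have "fst (w k) = fst (w t)" using w0 by simp
        then show ?thesis using tt by blast
      next
        case 2
        then have "fst (w k) = fst (w t)" using w2 by simp
        then show ?thesis using tt by blast
      qed blast
    qed
    then have "S u = {}" "T u = {}" using False by (force simp: S_def, force simp: T_def)
    then show ?thesis using False by (simp add: \<phi>_def)
  next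
    case True
    then obtain i where i: "i \<in> {1..<2 * t}" "fst u = fst (w i)" by blast
    consider "i \<noteq> t" "u = w i" | "i \<noteq> t" "u = neg (w i)" | "i = t" "u = w t" | "i = t" "u = neg (w t)"
      using i(2) by (auto simp: same_variable_iff)
    then show ?thesis
    proof cases
      case 1
      have "S u = {i}"
      proof -
        have "k = i" if "k < 2 * t" "u = w k" for k using var[OF i(1), of k] that 1 i(2) by auto
        then show ?thesis using 1 i(1) by (auto simp: S_def)
      qed
      moreover have "T u = {}"
      proof -
        have False if "k < 2 * t" "u = neg (w (Suc k))" for k
        proof -
          have "fst (w (Suc k)) = fst (w i)" using that i(2) by simp
          then have "Suc k = i" using var[OF i(1), of "Suc k"] that 1 by auto
          then show False using that 1 by auto
        qed
        then show ?thesis by (auto simp: T_def)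
      qed
      moreover have "\<phi> (w (Suc i)) = ?\<mu> * \<phi> u"
      proof -
        have "(2 * t - i) mod t \<noteq> 0"
        proof
          assume "(2 * t - i) mod t = 0"
          then have "t dvd i" using i(1) by (metis atLeastLessThan_iff diff_diff_cancel dvd_diff_nat dvd_triv_right less_imp_le mod_0_imp_dvd)
          then obtain q where "i = t * q" by blast
          then have "0 < q" "q < 2" "q \<noteq> 1" using i(1) 1 by auto
          then show False by linarith
        qed
        moreover have "2 * t - i = Suc (2 * t - Suc i)" using i(1) by auto
        ultimately have "(2 * t - i) mod t = Suc ((2 * t - Suc i) mod t)" by (metis mod_Suc)
        then show ?thesis using phi_w[of "Suc i"] phi_w[of i] i(1) 1 hS by simp
      qed
      ultimately show ?thesis by simp
    next
      case 2
      have "S u = {}"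
      proof -
        have False if "k < 2 * t" "u = w k" for k
        proof -
          have "k = i" using var[OF i(1), of k] that 2 i(2) by auto
          then show False using that 2 by auto
        qed
        then show ?thesis by (auto simp: S_def)
      qed
      moreover have "T u = {i - 1}"
      proof -
        have "k = i - 1" if "k < 2 * t" "u = neg (w (Suc k))" for k
        proof -
          have "fst (w (Suc k)) = fst (w i)" using that i(2) by simp
          then have "Suc k = i" using var[OF i(1), of "Suc k"] that 2 by auto
          then show ?thesis by simp
        qed
        moreover have "i - 1 < 2 * t" "u = neg (w (Suc (i - 1)))" using 2 i(1) by auto
        ultimately show ?thesis unfolding T_def lessThan_iff by blast
      qed
      moreover have "\<phi> (neg (w (i - 1))) = ?\<mu> * \<phi> u"
      proof -
        have "i mod t \<noteq> 0"
        proof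
          assume "i mod t = 0"
          then obtain q where "i = t * q" by blast
          then have "0 < q" "q < 2" "q \<noteq> 1" using i(1) 2 by auto
          then show False by linarith
        qed
        moreover have "i = Suc (i - 1)" using i(1) by auto
        ultimately have "i mod t = Suc ((i - 1) mod t)" by (metis mod_Suc)
        moreover have "i - 1 \<le> 2 * t" using i(1) by auto
        ultimately show ?thesis using phi_neg[of "i - 1"] phi_neg[of i] i(1) 2 hS by simp
      qed
      ultimately show ?thesis by simp
    next
      \<comment> \<open>At \<open>w t\<close> the walk continues the chain or, since
        \<open>w t = neg (w (2 * t))\<close>, takes its last implication by contraposition.\<close>
      case 3
      have "S u = {t}"
      proof -
        have "k = t" if "k < 2 * t" "u = w k" for k
          using var[OF i(1), of k] that 3 w0 by auto
        then show ?thesis using 3 t by (auto simp: S_def)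
      qed
      moreover have "T u = {2 * t - 1}"
      proof -
        have "k = 2 * t - 1" if "k < 2 * t" "u = neg (w (Suc k))" for k
        proof -
          have "fst (w (Suc k)) = fst (w i)" using that i(2) by simp
          then have "Suc k = t \<or> Suc k = 2 * t" using var[OF i(1), of "Suc k"] that 3 by auto
          then show ?thesis using that 3 by auto
        qed
        moreover have "2 * t - 1 < 2 * t" "u = neg (w (Suc (2 * t - 1)))" using 3 t w2 by auto
        ultimately show ?thesis unfolding T_def lessThan_iff by blast
      qed
      moreover have "\<phi> (w (Suc t)) = h (t - 1)" using phi_w[of "Suc t"] t by simp
      moreover have "\<phi> (neg (w (2 * t - 1))) = h (t - 1)"
      proof -
        have "2 * t - 1 = (t - 1) + t" using t by simp
        then have "(2 * t - 1) mod t = t - 1" using t by (metis One_nat_def Suc_le_lessD diff_less lessI mod_add_self2 mod_less)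
        then show ?thesis using phi_neg[of "2 * t - 1"] by simp
      qed
      moreover have "\<phi> u = 1" using phi_w[of t] 3 h0 by simp
      ultimately show ?thesis using ht by simp
    next
      \<comment> \<open>\<open>neg (w t)\<close> is \<open>w 0\<close>: the chain starts anew, or
        its implication into \<open>w t\<close> is taken by contraposition.\<close>
      case 4
      have "S u = {0}"
      proof -
        have "k = 0" if "k < 2 * t" "u = w k" for k
        proof -
          have "fst (w k) = fst (w i)" using that i(2) by simp
          then have "k = t \<or> k = 0" using var[OF i(1), of k] that 4 by auto
          then show ?thesis using that 4 by auto
        qed
        then show ?thesis using 4 t w0 by (auto simp: S_def)
      qed
      moreover have "T u = {t - 1}"
      proof -
        have "k = t - 1" if "k < 2 * t" "u = neg (w (Suc k))" for k
        proof -
          have "fst (w (Suc k)) = fst (w i)" using that i(2) by simp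
          then have "Suc k = t \<or> Suc k = 2 * t" using var[OF i(1), of "Suc k"] that 4 by auto
          moreover have "Suc k \<noteq> 2 * t" using that(2) 4 w2 by (metis neg_neg neg_neq(1))
          ultimately show ?thesis by linarith
        qed
        moreover have "t - 1 < 2 * t" "u = neg (w (Suc (t - 1)))" using 4 t by simp_all
        ultimately show ?thesis unfolding T_def lessThan_iff by blast
      qed
      moreover have "\<phi> (w (Suc 0)) = h (t - 1)"
      proof -
        have "2 * t - 1 = (t - 1) + t" using t by simp
        then have "(2 * t - 1) mod t = t - 1" using t by (metis One_nat_def Suc_le_lessD diff_less lessI mod_add_self2 mod_less)
        then show ?thesis using phi_w[of 1] t by simp
      qed
      moreover have "\<phi> (neg (w (t - 1))) = h (t - 1)" using phi_neg[of "t - 1"] t by simp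
      moreover have "\<phi> u = 1" using phi_neg[of t] 4 h0 by simp
      ultimately show ?thesis using ht by simp
    qed
  qed
  then have "\<forall>u. (\<Sum>k<2*t. (if u = w k then \<phi> (w (Suc k)) else 0)) +
         (\<Sum>k<2*t. (if u = neg (w (Suc k)) then \<phi> (neg (w k)) else 0)) \<le> ?\<mu> * \<phi> u"
    unfolding S_def T_def sum.inter_filter[OF finite_lessThan] by blast
  moreover have "\<forall>u. fst u \<in> ?vars \<longrightarrow> 1 / 2 \<le> \<phi> u \<and> \<phi> u \<le> 1"
    using h_le h_ge by (auto simp: \<phi>_def)
  moreover have "\<forall>u. fst u \<notin> ?vars \<longrightarrow> \<phi> u = 0" by (simp add: \<phi>_def)
  ultimately show ?thesis by blast
qed

section \<open>Correlation of two snakes\<close>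

text \<open>Lists of length t - 1 put t implications on each half, so that the branching literals
  are equally spaced, as the eigenfunction requires.\<close>

definition snakes :: "nat \<Rightarrow> nat \<Rightarrow> (literal list \<times> literal \<times> literal list) set" where
  "snakes n t = {(us, y, vs). set us \<subseteq> lits n \<and> length us = t - 1 \<and> y \<in> lits n \<and>
     set vs \<subseteq> lits n \<and> length vs = t - 1 \<and> distinct (map fst (us @ y # vs))}"

definition snake_clauses :: "literal list \<times> literal \<times> literal list \<Rightarrow> clause list" where
  "snake_clauses = (\<lambda>(us, y, vs). path_clauses (neg y) (us @ y # vs) (neg y))"

definition positions :: "nat \<Rightarrow> nat \<Rightarrow> nat list set" where
  "positions m k = {is. length is = k \<and> distinct is \<and> set is \<subseteq> {..<m}}"

definition occurs_at :: "clause list \<Rightarrow> nat list \<Rightarrow> formula set" where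
  "occurs_at cs is = {F. \<forall>(i, c)\<in>set (zip is cs). F ! i = c}"

text \<open>An upper bound for the expected number of positions carrying \<open>{neg u, v}\<close>
  once the snake \<open>cs\<close> is pinned: \<kappa> stands for m * 2 / (n (n - 1)) and covers
  fresh positions. Comparing clauses as sets counts an implication together with its
  contrapositive.\<close>

definition snake_kernel :: "real \<Rightarrow> real \<Rightarrow> clause list \<Rightarrow> literal \<Rightarrow> literal \<Rightarrow> real" where
  "snake_kernel p \<kappa> cs u v =
     \<kappa> * bias p (neg u) * bias p v + (\<Sum>k<length cs. of_bool (cs ! k = {neg u, v}))"

lemma length_snake_clauses:
  "S \<in> snakes n t \<Longrightarrow> 1 \<le> t \<Longrightarrow> length (snake_clauses S) = 2 * t"
  by (auto simp: snakes_def snake_clauses_def)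

lemma finite_snakes [simp]: "finite (snakes n t)"
proof (rule finite_subset)
  let ?L = "{us. set us \<subseteq> lits n \<and> length us = t - 1}"
  show "snakes n t \<subseteq> ?L \<times> lits n \<times> ?L" by (auto simp: snakes_def)
  show "finite (?L \<times> lits n \<times> ?L)" by (simp add: finite_lists_length_eq)
qed

lemma finite_positions [simp]: "finite (positions m k)"
  by (rule finite_subset[OF _ finite_lists_length_eq[of "{..<m}" k]]) (auto simp: positions_def)

lemma bias_bounds: "0 < p \<Longrightarrow> p < 1 \<Longrightarrow> 0 \<le> bias p l \<and> bias p l \<le> 1"
  by (simp add: bias_def)

text \<open>A pivot off the variables of \<open>S\<close> meets the clean estimate in both halves;
  together these pivots give the main term. At most 4t literals lie on those variables, and there
  each half loses a factor of order t^2.\<close>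

lemma snake_walk_bound:
  assumes p: "0 < p" "p < 1" and t: "1 \<le> t" and S: "S \<in> snakes n t"
    and c: "0 \<le> c" and \<kappa>: "0 \<le> \<kappa>"
    and \<theta>: "\<theta> = \<kappa> * (2 * real n * (p * (1 - p)) + c * (4 * real t))"
    and \<mu>: "2 powr (1 / t) \<le> \<theta>" "2 powr (1 / t) * (2 + c) \<le> \<theta> * c"
    and big: "4 \<le> \<kappa> * \<theta> ^ (t - 1)"
  shows "(\<Sum>y\<in>lits n. walk_sum (snake_kernel p \<kappa> (snake_clauses S)) (lits n) (t - 1) (neg y) y *
                     walk_sum (snake_kernel p \<kappa> (snake_clauses S)) (lits n) (t - 1) y (neg y))
    \<le> (\<kappa> * \<theta> ^ (t - 1))\<^sup>2 * (2 * real n * (p * (1 - p))\<^sup>2 + 4 * real t * (9 * (1 + c) * (real t)\<^sup>2)\<^sup>2)"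
proof -
  obtain us y vs where Seq: "S = (us, y, vs)" by (cases S)
  let ?ws = "us @ y # vs"
  have len: "length us = t - 1" "length vs = t - 1" and dist: "distinct (map fst ?ws)"
    using S Seq by (auto simp: snakes_def)
  define w where "w j = (neg y # ?ws @ [neg y]) ! j" for j
  define cs where "cs = snake_clauses S"
  have lcs: "length cs = 2 * t" using length_snake_clauses[OF S t] by (simp add: cs_def)
  have lws: "length ?ws = 2 * t - 1" using len t by simp
  have w0: "w 0 = neg y" by (simp add: w_def)
  have w2: "w (2 * t) = neg y"
  proof -
    have "2 * t = Suc (length ?ws)" using len t by simp
    then show ?thesis unfolding w_def by (metis nth_Cons_Suc nth_append_length)
  qed
  have wmid: "w j = ?ws ! (j - 1)" if "j \<in> {1..<2 * t}" for j
  proof -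
    have "j = Suc (j - 1)" "j - 1 < length ?ws" using that lws by auto
    then show ?thesis unfolding w_def by (metis nth_Cons_Suc nth_append)
  qed
  have wt: "w t = y"
  proof -
    have "w t = ?ws ! length us" using wmid[of t] t len by simp
    then show ?thesis by simp
  qed
  have inj: "inj_on (\<lambda>j. fst (w j)) {1..<2 * t}"
  proof (rule inj_onI)
    fix i j assume ij: "i \<in> {1..<2 * t}" "j \<in> {1..<2 * t}" "fst (w i) = fst (w j)"
    have l: "i - 1 < length ?ws" "j - 1 < length ?ws" using ij lws by auto
    then have "map fst ?ws ! (i - 1) = map fst ?ws ! (j - 1)"
      using ij by (simp only: nth_map wmid)
    then have "i - 1 = j - 1" using dist l nth_eq_iff_index_eq by (metis length_map)
    then show "i = j" using ij by auto
  qed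
  define vars where "vars = (\<lambda>j. fst (w j)) ` {1..<2 * t}"
  have "w 0 = neg (w t)" "w (2 * t) = neg (w t)" using w0 w2 wt by simp_all
  from snake_eigenfunction[OF t this inj] obtain \<phi> :: "literal \<Rightarrow> real" where
    "(\<forall>u. fst u \<in> vars \<longrightarrow> 1 / 2 \<le> \<phi> u \<and> \<phi> u \<le> 1) \<and> (\<forall>u. fst u \<notin> vars \<longrightarrow> \<phi> u = 0) \<and>
     (\<forall>u. (\<Sum>k<2*t. (if u = w k then \<phi> (w (Suc k)) else 0)) +
         (\<Sum>k<2*t. (if u = neg (w (Suc k)) then \<phi> (neg (w k)) else 0)) \<le> 2 powr (1 / t) * \<phi> u)"
    unfolding vars_def by (elim exE)
  then have phi1: "\<And>u. fst u \<in> vars \<Longrightarrow> 1 / 2 \<le> \<phi> u \<and> \<phi> u \<le> 1"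
    and phi0: "\<And>u. fst u \<notin> vars \<Longrightarrow> \<phi> u = 0"
    and phiM: "\<And>u. (\<Sum>k<2*t. (if u = w k then \<phi> (w (Suc k)) else 0)) +
         (\<Sum>k<2*t. (if u = neg (w (Suc k)) then \<phi> (neg (w k)) else 0)) \<le> 2 powr (1 / t) * \<phi> u"
    by blast+
  have phi_nn: "0 \<le> \<phi> u" for u using phi1[of u] phi0[of u] by (cases "fst u \<in> vars") auto
  have phi_le: "\<phi> u \<le> 1" for u using phi1[of u] phi0[of u] by (cases "fst u \<in> vars") auto
  have csk: "cs ! k = {neg (w k), w (Suc k)}" if "k < 2 * t" for k
    unfolding cs_def Seq snake_clauses_def w_def prod.case
    using that lws by (intro path_clauses_nth) simp
  have wvars: "fst (w k) \<in> vars" if le: "k \<le> 2 * t" for k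
  proof -
    have tt: "t \<in> {1..<2 * t}" using t by simp
    then have "fst y \<in> vars" unfolding vars_def using wt by force
    moreover have "k = 0 \<or> k = 2 * t \<or> k \<in> {1..<2 * t}" using le by force
    moreover have "fst (w j) \<in> vars" if "j \<in> {1..<2 * t}" for j using that by (simp add: vars_def)
    ultimately show ?thesis using w0 w2 by (metis fst_neg)
  qed
  define M where "M u v = (\<Sum>k<2*t. of_bool (cs ! k = {neg u, v}) :: real)" for u v
  have kernel: "snake_kernel p \<kappa> cs = (\<lambda>u v. \<kappa> * bias p (neg u) * bias p v + M u v)"
    by (intro ext) (simp add: snake_kernel_def M_def lcs)
  have M_phi: "(\<Sum>v\<in>lits n. M u v * \<phi> v) \<le> 2 powr (1 / t) * \<phi> u" for u
  proof -
    have "(\<Sum>v\<in>lits n. M u v * \<phi> v) = (\<Sum>k<2*t. \<Sum>v\<in>lits n. of_bool (cs ! k = {neg u, v}) * \<phi> v)"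
      unfolding M_def sum_distrib_right by (rule sum.swap)
    also have "\<dots> \<le> (\<Sum>k<2*t. (if u = w k then \<phi> (w (Suc k)) else 0) + (if u = neg (w (Suc k)) then \<phi> (neg (w k)) else 0))"
    proof (rule sum_mono)
      fix k assume "k \<in> {..<2*t}"
      then have "cs ! k = {neg (w k), w (Suc k)}" using csk by simp
      then have eq: "cs ! k = {neg u, v} \<longleftrightarrow> (u = w k \<and> v = w (Suc k)) \<or> (u = neg (w (Suc k)) \<and> v = neg (w k))" for v
        by (auto simp: doubleton_eq_iff)
      have "(\<Sum>v\<in>lits n. of_bool (cs ! k = {neg u, v}) * \<phi> v) \<le>
        (\<Sum>v\<in>lits n. (if v = w (Suc k) then (if u = w k then \<phi> (w (Suc k)) else 0) else 0) +
            (if v = neg (w k) then (if u = neg (w (Suc k)) then \<phi> (neg (w k)) else 0) else 0))"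
        unfolding eq using phi_nn by (intro sum_mono) auto
      also have "\<dots> \<le> (if u = w k then \<phi> (w (Suc k)) else 0) + (if u = neg (w (Suc k)) then \<phi> (neg (w k)) else 0)"
        unfolding sum.distrib using phi_nn by (intro add_mono) (auto simp: sum.delta)
      finally show "(\<Sum>v\<in>lits n. of_bool (cs ! k = {neg u, v}) * \<phi> v) \<le> \<dots>" .
    qed
    also have "\<dots> \<le> 2 powr (1 / t) * \<phi> u" using phiM[of u] by (simp add: sum.distrib)
    finally show ?thesis .
  qed
  have M0: "M u v = 0" if "fst v \<notin> vars" for u v
  proof -
    have "cs ! k \<noteq> {neg u, v}" if k: "k < 2 * t" for k
    proof
      assume "cs ! k = {neg u, v}"
      then have "v = w (Suc k) \<or> v = neg (w k)" using csk[OF k] by (auto simp: doubleton_eq_iff)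
      then show False using wvars[of k] wvars[of "Suc k"] k \<open>fst v \<notin> vars\<close> by auto
    qed
    then show ?thesis by (simp add: M_def)
  qed
  have cardvars: "card {v. fst v \<in> vars \<and> v \<in> lits n} \<le> 4 * t"
  proof -
    have "card {v. fst v \<in> vars \<and> v \<in> lits n} \<le> card (vars \<times> (UNIV :: bool set))"
      by (intro card_mono) (auto simp: vars_def)
    also have "\<dots> = card vars * 2" by (simp add: card_cartesian_product)
    also have "card vars \<le> card {1..<2 * t}" unfolding vars_def by (rule card_image_le) simp
    finally show ?thesis by simp
  qed
  have split: "(\<Sum>v\<in>lits n. if fst v \<in> vars then X else 0) = real (card {v. fst v \<in> vars \<and> v \<in> lits n}) * X" for X :: real
  proof -
    have "{v \<in> lits n. fst v \<in> vars} = {v. fst v \<in> vars \<and> v \<in> lits n}" by auto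
    then show ?thesis using sum.inter_filter[of "lits n" "\<lambda>_. X" "\<lambda>v. fst v \<in> vars"] by simp
  qed
  have a_phi: "(\<Sum>v\<in>lits n. bias p v * \<phi> v) \<le> 4 * real t"
  proof -
    have "(\<Sum>v\<in>lits n. bias p v * \<phi> v) \<le> (\<Sum>v\<in>lits n. if fst v \<in> vars then 1 else 0)"
      using phi0 phi_le phi_nn bias_bounds[OF p] by (intro sum_mono) (auto intro!: mult_le_one)
    also have "\<dots> \<le> 4 * real t" unfolding split using cardvars by simp
    finally show ?thesis .
  qed
  have ab: "(\<Sum>v\<in>lits n. bias p v * bias p (neg v)) = 2 * real n * (p * (1 - p))"
    by (simp add: bias_mult_neg card_lits)
  interpret perturbed_kernel "lits n" "{v. fst v \<in> vars}" "bias p" "\<lambda>u. bias p (neg u)" \<phi> M \<kappa> "2 powr (1 / t)" \<theta> c "4 * real t"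
    by unfold_locales
      (use bias_bounds[OF p] phi_nn phi1 M0 M_phi a_phi \<kappa> c \<mu> \<theta> ab in
        \<open>auto simp: M_def intro: sum_nonneg\<close>)
  have Keq: "snake_kernel p \<kappa> (snake_clauses S) = K"
    unfolding cs_def[symmetric] kernel by (intro ext) (simp add: K_def)
  define X where "X = \<kappa> * \<theta> ^ (t - 1)"
  \<comment> \<open>\<open>walk_sum_inside\<close> with N = 4t yields 1 + 8t(t - 1) \<le> 8 t^2,
    times at most 1 + c; one further unit for the term in \<open>\<phi>\<close> makes 9.\<close>
  define C where "C = 9 * (1 + c) * (real t)\<^sup>2"
  have X0: "0 \<le> X" using big by (simp add: X_def)
  have nn: "0 \<le> walk_sum K (lits n) (t - 1) u v" for u v
    by (rule walk_sum_nonneg) (rule K_nonneg)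
  have outside: "walk_sum K (lits n) (t - 1) (neg z) z \<le> X * (bias p z * bias p z)" if "fst z \<notin> vars" for z
    using walk_sum_outside[of z "t - 1" "neg z"] that phi0[of "neg z"] by (simp add: X_def mult_ac)
  have inside: "walk_sum K (lits n) (t - 1) (neg z) z \<le> X * C" if "fst z \<in> vars" "z \<in> lits n" for z
  proof -
    let ?u = "neg z"
    have "walk_sum K (lits n) (t - 1) ?u z \<le> 2 * (2 powr (1 / t)) ^ Suc (t - 1) * \<phi> ?u
        + \<kappa> * (1 + 2 * (4 * real t) * real (t - 1)) * \<theta> ^ (t - 1) * (bias p (neg ?u) + c * \<phi> ?u)"
      by (rule walk_sum_inside) (use that in auto)
    also have "(2 powr (1 / t)) ^ Suc (t - 1) = (2::real)"
      using t by (simp add: powr_realpow[symmetric] powr_powr del: power_Suc)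
    \<comment> \<open>The t-th power of the rate is 2, so the term in \<open>\<phi>\<close> is at
      most 4; this is the 4 in \<open>big\<close>.\<close>
    also have "2 * 2 * \<phi> ?u \<le> X" using phi_le[of ?u] big by (simp add: X_def)
    also have "\<kappa> * (1 + 2 * (4 * real t) * real (t - 1)) * \<theta> ^ (t - 1) * (bias p (neg ?u) + c * \<phi> ?u)
        = X * ((1 + 2 * (4 * real t) * real (t - 1)) * (bias p (neg ?u) + c * \<phi> ?u))"
      by (simp add: X_def mult_ac)
    also have "\<dots> \<le> X * ((8 * (real t)\<^sup>2) * (1 + c))"
    proof (intro mult_left_mono X0 mult_mono)
      show "1 + 2 * (4 * real t) * real (t - 1) \<le> 8 * (real t)\<^sup>2"
        using t by (simp add: of_nat_diff power2_eq_square algebra_simps)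
      show "bias p (neg ?u) + c * \<phi> ?u \<le> 1 + c"
        using bias_bounds[OF p] phi_le c mult_left_mono[of "\<phi> ?u" 1 c] by (intro add_mono) auto
    qed (use bias_bounds[OF p] phi_nn c in auto)
    also have "X + X * ((8 * (real t)\<^sup>2) * (1 + c)) \<le> X * C"
    proof -
      have "1 * 1 \<le> (real t)\<^sup>2 * (1 + c)" using t c by (intro mult_mono) auto
      then have "1 + 8 * (real t)\<^sup>2 * (1 + c) \<le> C" by (simp add: C_def algebra_simps)
      then have "X * (1 + 8 * (real t)\<^sup>2 * (1 + c)) \<le> X * C" using X0 by (rule mult_left_mono)
      then show ?thesis by (simp add: algebra_simps)
    qed
    finally show ?thesis by simp
  qed
  have "(\<Sum>y\<in>lits n. walk_sum K (lits n) (t - 1) (neg y) y * walk_sum K (lits n) (t - 1) y (neg y))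
    \<le> (\<Sum>y\<in>lits n. X\<^sup>2 * (p * (1 - p))\<^sup>2 + (if fst y \<in> vars then (X * C)\<^sup>2 else 0))"
  proof (rule sum_mono)
    fix z assume z: "z \<in> lits n"
    show "walk_sum K (lits n) (t - 1) (neg z) z * walk_sum K (lits n) (t - 1) z (neg z)
      \<le> X\<^sup>2 * (p * (1 - p))\<^sup>2 + (if fst z \<in> vars then (X * C)\<^sup>2 else 0)"
    proof (cases "fst z \<in> vars")
      case True
      have "walk_sum K (lits n) (t - 1) (neg z) z * walk_sum K (lits n) (t - 1) z (neg z) \<le> (X * C) * (X * C)"
        using inside[of z] inside[of "neg z"] True z nn X0 c by (intro mult_mono) (auto simp: C_def)
      then show ?thesis using True by (simp add: power2_eq_square add_increasing)
    next
      case False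
      have "walk_sum K (lits n) (t - 1) (neg z) z * walk_sum K (lits n) (t - 1) z (neg z)
         \<le> (X * (bias p z * bias p z)) * (X * (bias p (neg z) * bias p (neg z)))"
        using outside[of z] outside[of "neg z"] False nn X0 bias_bounds[OF p] by (intro mult_mono) auto
      also have "\<dots> = X\<^sup>2 * (bias p z * bias p (neg z))\<^sup>2" by (simp add: power2_eq_square)
      finally show ?thesis using False by (simp add: bias_mult_neg)
    qed
  qed
  also have "\<dots> = 2 * real n * (X\<^sup>2 * (p * (1 - p))\<^sup>2) + real (card {v. fst v \<in> vars \<and> v \<in> lits n}) * (X * C)\<^sup>2"
    by (simp add: sum.distrib split card_lits)
  also have "\<dots> \<le> 2 * real n * (X\<^sup>2 * (p * (1 - p))\<^sup>2) + real (4 * t) * (X * C)\<^sup>2"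
    using cardvars by (intro add_left_mono mult_right_mono) (auto simp only: of_nat_le_iff zero_le_power2)
  also have "\<dots> = X\<^sup>2 * (2 * real n * (p * (1 - p))\<^sup>2 + 4 * real t * C\<^sup>2)"
    by (simp add: power_mult_distrib algebra_simps)
  finally show ?thesis unfolding Keq X_def C_def .
qed

text \<open>Forgetting that the variables are distinct only adds nonnegative terms, and it decouples
  the halves into independent walks from \<open>neg y\<close> to \<open>y\<close> and back.\<close>

lemma sum_snakes_le:
  fixes g :: "clause \<Rightarrow> real"
  assumes "\<And>c. 0 \<le> g c"
  shows "(\<Sum>S\<in>snakes n t. prod_list (map g (snake_clauses S)))
     \<le> (\<Sum>y\<in>lits n. walk_sum (\<lambda>a b. g {neg a, b}) (lits n) (t - 1) (neg y) y *
                     walk_sum (\<lambda>a b. g {neg a, b}) (lits n) (t - 1) y (neg y))"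
proof -
  let ?L = "{us. set us \<subseteq> lits n \<and> length us = t - 1}"
  have fin: "finite ?L" by (simp add: finite_lists_length_eq)
  have "(\<Sum>S\<in>snakes n t. prod_list (map g (snake_clauses S)))
     \<le> (\<Sum>S\<in>?L \<times> lits n \<times> ?L. prod_list (map g (snake_clauses S)))"
    using fin assms by (intro sum_mono2) (auto simp: snakes_def intro!: prod_list_nonneg)
  also have "\<dots> = (\<Sum>us\<in>?L. \<Sum>y\<in>lits n. \<Sum>vs\<in>?L. prod_list (map g (path_clauses (neg y) us y)) * prod_list (map g (path_clauses y vs (neg y))))"
    by (simp add: sum.cartesian_product case_prod_unfold snake_clauses_def path_clauses_append)
  also have "\<dots> = (\<Sum>y\<in>lits n. \<Sum>us\<in>?L. \<Sum>vs\<in>?L. prod_list (map g (path_clauses (neg y) us y)) * prod_list (map g (path_clauses y vs (neg y))))"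
    by (rule sum.swap)
  also have "\<dots> = (\<Sum>y\<in>lits n. walk_sum (\<lambda>a b. g {neg a, b}) (lits n) (t - 1) (neg y) y *
                     walk_sum (\<lambda>a b. g {neg a, b}) (lits n) (t - 1) y (neg y))"
    by (simp only: sum_product[symmetric] sum_path_clauses_eq_walk_sum[OF finite_lits])
  finally show ?thesis .
qed

text \<open>With the first snake pinned at \<open>f\<close>, the joint probability is a product over
  the clauses of the second. Admitting repeated positions only enlarges the sum, which then becomes
  a product of \<open>G\<close>, the conditional expected number of positions of a clause.\<close>

lemma snake_correlation:
  fixes m :: nat
  assumes p: "0 < p" "p < 1" and n: "2 \<le> n" and t: "1 \<le> t" and S: "S \<in> snakes n t"
    and f: "f \<in> positions m (2 * t)"
    and \<kappa>: "\<kappa> = real m * (2 / (real n * (real n - 1)))"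
  defines "M \<equiv> biased_formula p 2 m n"
  shows "(\<Sum>(S', g)\<in>snakes n t \<times> positions m (2 * t).
      measure_pmf.prob M (occurs_at (snake_clauses S) f \<inter> occurs_at (snake_clauses S') g))
    \<le> (\<Sum>y\<in>lits n. walk_sum (snake_kernel p \<kappa> (snake_clauses S)) (lits n) (t - 1) (neg y) y *
                     walk_sum (snake_kernel p \<kappa> (snake_clauses S)) (lits n) (t - 1) y (neg y))
      * measure_pmf.prob M (occurs_at (snake_clauses S) f)"
proof -
  let ?P = "biased_clause p 2 n"
  define cs where "cs = snake_clauses S"
  have lcs: "length cs = 2 * t" using length_snake_clauses[OF S t] by (simp add: cs_def)
  have f': "length f = 2 * t" "distinct f" "set f \<subseteq> {..<m}" using f by (auto simp: positions_def)
  define a where "a i = the (map_of (zip f cs) i)" for i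
  have a_nth: "a (f ! k) = cs ! k" if "k < 2 * t" for k
  proof -
    have "map_of (zip f cs) (f ! k) = Some (cs ! k)"
      using f' lcs that by (intro map_of_is_SomeI) (auto simp: set_zip)
    then show ?thesis by (simp add: a_def)
  qed
  have occ: "occurs_at cs f = {F. \<forall>i\<in>set f. F ! i = a i}"
  proof -
    have "(\<forall>(i, c)\<in>set (zip f cs). F ! i = c) \<longleftrightarrow> (\<forall>k<2*t. F ! (f ! k) = cs ! k)" for F
      using f' lcs by (auto simp: set_zip)
    moreover have "(\<forall>i\<in>set f. F ! i = a i) \<longleftrightarrow> (\<forall>k<2*t. F ! (f ! k) = cs ! k)" for F
      using f' a_nth by (auto simp: all_set_conv_all_nth)
    ultimately show ?thesis by (auto simp: occurs_at_def)
  qed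
  define h where "h i c = (if i \<in> set f then of_bool (a i = c) else pmf ?P c)" for i c
  define P0 where "P0 = measure_pmf.prob M (occurs_at cs f)"
  have P0: "P0 = (\<Prod>i\<in>set f. pmf ?P (a i))"
    unfolding P0_def M_def biased_formula_def occ using f' by (intro prob_replicate_pmf_at) auto
  have joint: "measure_pmf.prob M (occurs_at cs f \<inter> occurs_at cs' g)
      = P0 * prod_list (map (\<lambda>(i, c). h i c) (zip g cs'))"
    if "g \<in> positions m (2 * t)" "length cs' = 2 * t" for g cs'
  proof -
    have "occurs_at cs f \<inter> occurs_at cs' g = {F. (\<forall>i\<in>set f. F ! i = a i) \<and> (\<forall>(i, c)\<in>set (zip g cs'). F ! i = c)}"
      unfolding occ by (auto simp: occurs_at_def)
    then show ?thesis unfolding P0 M_def biased_formula_def h_def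
      using prob_replicate_pmf_zip[of "set f" m g cs' ?P a] f' that by (simp add: positions_def)
  qed
  have h_nn: "0 \<le> h i c" for i c by (simp add: h_def)
  define G where "G c = (\<Sum>i<m. h i c)" for c
  have G_nn: "0 \<le> G c" for c unfolding G_def by (intro sum_nonneg h_nn)
  have G_le: "G {neg u, v} \<le> snake_kernel p \<kappa> cs u v" for u v
  proof -
    let ?c = "{neg u, v}"
    have "G ?c \<le> (\<Sum>i<m. pmf ?P ?c + (if i \<in> set f then of_bool (a i = ?c) else 0))"
      unfolding G_def h_def by (intro sum_mono) auto
    also have "\<dots> = real m * pmf ?P ?c + (\<Sum>i\<in>set f. of_bool (a i = ?c))"
    proof -
      have "{i \<in> {..<m}. i \<in> set f} = set f" using f' by auto
      then show ?thesis using sum.inter_filter[of "{..<m}" "\<lambda>i. of_bool (a i = ?c) :: real" "\<lambda>i. i \<in> set f"]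
        by (simp add: sum.distrib)
    qed
    also have "(\<Sum>i\<in>set f. of_bool (a i = ?c)) = (\<Sum>k<2*t. of_bool (cs ! k = ?c) :: real)"
    proof -
      have "(\<Sum>i\<in>set f. of_bool (a i = ?c) :: real) = (\<Sum>k<2*t. of_bool (a (f ! k) = ?c))"
        using f' by (intro sum.reindex_bij_betw[symmetric] bij_betw_nth) auto
      then show ?thesis using a_nth by simp
    qed
    also have "real m * pmf ?P ?c \<le> real m * (2 / (real n * (real n - 1)) * bias p (neg u) * bias p v)"
      by (intro mult_left_mono pmf_biased_clause_2_le[OF p n]) simp
    finally show ?thesis by (simp add: snake_kernel_def lcs \<kappa> mult.assoc)
  qed
  have "(\<Sum>(S', g)\<in>snakes n t \<times> positions m (2 * t).
      measure_pmf.prob M (occurs_at cs f \<inter> occurs_at (snake_clauses S') g))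
     = (\<Sum>S'\<in>snakes n t. \<Sum>g\<in>positions m (2 * t). P0 * prod_list (map (\<lambda>(i, c). h i c) (zip g (snake_clauses S'))))"
    unfolding sum.cartesian_product[symmetric]
    by (intro sum.cong refl joint length_snake_clauses[OF _ t])
  also have "\<dots> \<le> (\<Sum>S'\<in>snakes n t. P0 * prod_list (map G (snake_clauses S')))"
  proof (rule sum_mono)
    fix S' assume S': "S' \<in> snakes n t"
    let ?c = "snake_clauses S'"
    have nn: "0 \<le> prod_list (map (\<lambda>(i, c). h i c) (zip g ?c))" for g
      using h_nn by (intro prod_list_nonneg) auto
    have "(\<Sum>g\<in>positions m (2 * t). prod_list (map (\<lambda>(i, c). h i c) (zip g ?c))) \<le>
       (\<Sum>g | set g \<subseteq> {..<m} \<and> length g = length ?c. prod_list (map (\<lambda>(i, c). h i c) (zip g ?c)))"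
      using nn length_snake_clauses[OF S' t]
      by (intro sum_mono2) (auto simp: positions_def finite_lists_length_eq)
    also have "\<dots> = prod_list (map G ?c)" unfolding G_def by (rule sum_lists_prod_zip) simp
    finally show "(\<Sum>g\<in>positions m (2 * t). P0 * prod_list (map (\<lambda>(i, c). h i c) (zip g ?c))) \<le> P0 * prod_list (map G ?c)"
      unfolding sum_distrib_left[symmetric] by (rule mult_left_mono) (simp add: P0_def)
  qed
  also have "\<dots> \<le> P0 * (\<Sum>y\<in>lits n. walk_sum (\<lambda>a b. G {neg a, b}) (lits n) (t - 1) (neg y) y *
                     walk_sum (\<lambda>a b. G {neg a, b}) (lits n) (t - 1) y (neg y))"
    unfolding sum_distrib_left[symmetric]
    by (intro mult_left_mono sum_snakes_le G_nn) (simp add: P0_def)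
  also have "\<dots> \<le> P0 * (\<Sum>y\<in>lits n. walk_sum (snake_kernel p \<kappa> cs) (lits n) (t - 1) (neg y) y *
                     walk_sum (snake_kernel p \<kappa> cs) (lits n) (t - 1) y (neg y))"
  proof -
    have k: "0 \<le> snake_kernel p \<kappa> cs u v" for u v using order_trans[OF G_nn G_le] .
    show ?thesis
      by (intro mult_left_mono sum_mono mult_mono walk_sum_mono walk_sum_nonneg G_nn G_le k) (simp add: P0_def)
  qed
  finally show ?thesis by (simp add: cs_def P0_def mult.commute)
qed

section \<open>First moment of snakes\<close>

text \<open>The first moment must be bounded from below, so equality is needed: neighbouring
  literals on different variables make every clause a genuine one.\<close>

lemma prod_list_path_clauses_eq:
  assumes p: "0 < p" "p < 1" and n: "2 \<le> n"
    and "successively (\<lambda>a b. fst a \<noteq> fst b) (u # ws @ [v])" "set (u # ws @ [v]) \<subseteq> lits n"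
  defines "k \<equiv> 2 / (real n * (real n - 1))"
  shows "prod_list (map (pmf (biased_clause p 2 n)) (path_clauses u ws v))
     = k ^ Suc (length ws) * (p * (1 - p)) ^ length ws * (bias p (neg u) * bias p v)"
  using assms(4,5)
proof (induction ws arbitrary: u)
  case Nil
  then show ?case using pmf_biased_clause_2[OF p n, of "neg u" v] by (simp add: k_def mult.assoc)
next
  case (Cons w ws)
  have 1: "pmf (biased_clause p 2 n) {neg u, w} = k * bias p (neg u) * bias p w"
    using pmf_biased_clause_2[OF p n, of "neg u" w] Cons.prems by (simp add: k_def)
  have 2: "prod_list (map (pmf (biased_clause p 2 n)) (path_clauses w ws v))
     = k ^ Suc (length ws) * (p * (1 - p)) ^ length ws * (bias p (neg w) * bias p v)"
    by (rule Cons.IH) (use Cons.prems in auto)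
  have "prod_list (map (pmf (biased_clause p 2 n)) (path_clauses u (w # ws) v)) =
    (k * bias p (neg u) * bias p w) * (k ^ Suc (length ws) * (p * (1 - p)) ^ length ws * (bias p (neg w) * bias p v))"
    using 1 2 by simp
  also have "\<dots> = k ^ Suc (length (w # ws)) * ((bias p w * bias p (neg w)) * (p * (1 - p)) ^ length ws) * (bias p (neg u) * bias p v)"
    by simp
  finally show ?case unfolding bias_mult_neg by simp
qed

lemma successively_distinct_map:
  "distinct (map f xs) \<Longrightarrow> successively (\<lambda>a b. f a \<noteq> f b) xs"
proof (induction xs)
  case (Cons x xs)
  then show ?case by (cases xs) auto
qed simp

text \<open>The two ends pair up as well: \<open>y\<close> in the first clause and
  \<open>neg y\<close> in the last give one more factor p (1 - p). For t = 1 the clauses would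
  degenerate to singletons, which have probability 0.\<close>

lemma prob_snake_occurs:
  assumes p: "0 < p" "p < 1" and n: "2 \<le> n" and t: "2 \<le> t" and S: "S \<in> snakes n t"
    and f: "f \<in> positions m (2 * t)"
  shows "measure_pmf.prob (biased_formula p 2 m n) (occurs_at (snake_clauses S) f)
    = (2 / (real n * (real n - 1)) * (p * (1 - p))) ^ (2 * t)"
proof -
  obtain us y vs where Seq: "S = (us, y, vs)" by (cases S)
  have s: "set us \<subseteq> lits n" "length us = t - 1" "y \<in> lits n" "set vs \<subseteq> lits n" "length vs = t - 1"
    "distinct (map fst (us @ y # vs))" using S Seq by (auto simp: snakes_def)
  let ?k = "2 / (real n * (real n - 1))"
  have ne: "us \<noteq> []" "vs \<noteq> []" using s t by auto
  have "hd us \<in> set us" "last vs \<in> set vs" using ne by auto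
  then have hl: "fst (hd us) \<noteq> fst y" "fst (last vs) \<noteq> fst y" using s(6) by (auto simp: image_iff)
  have "successively (\<lambda>a b. fst a \<noteq> fst b) (neg y # (us @ y # vs) @ [neg y])"
    using successively_distinct_map[OF s(6)] hl ne
    by (auto simp: successively_Cons successively_append_iff)
  then have "prod_list (map (pmf (biased_clause p 2 n)) (snake_clauses S))
     = ?k ^ Suc (length (us @ y # vs)) * (p * (1 - p)) ^ length (us @ y # vs) * (bias p (neg (neg y)) * bias p (neg y))"
    unfolding Seq snake_clauses_def prod.case using s by (intro prod_list_path_clauses_eq[OF p n]) auto
  also have "length (us @ y # vs) = 2 * t - 1" using s t by simp
  also have "bias p (neg (neg y)) * bias p (neg y) = p * (1 - p)" by (simp add: bias_mult_neg)
  also have "?k ^ Suc (2 * t - 1) * (p * (1 - p)) ^ (2 * t - 1) * (p * (1 - p)) = ?k ^ Suc (2 * t - 1) * (p * (1 - p)) ^ Suc (2 * t - 1)"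
    by simp
  also have "Suc (2 * t - 1) = 2 * t" using t by simp
  finally have "prod_list (map (pmf (biased_clause p 2 n)) (snake_clauses S)) = (?k * (p * (1 - p))) ^ (2 * t)"
    by (simp only: power_mult_distrib)
  then show ?thesis using f length_snake_clauses[OF S] t
    unfolding occurs_at_def biased_formula_def positions_def by (subst prob_replicate_pmf_positions) auto
qed

text \<open>The falling factorial is at least (n - k)^k, and Bernoulli's inequality applies to (1 -
  k/n)^k. For k > n the left side is not positive.\<close>

lemma card_distinct_lists_ge:
  assumes "1 \<le> n"
  shows "real n ^ k * (1 - (real k)\<^sup>2 / real n) \<le> real (card {xs. length xs = k \<and> distinct xs \<and> set xs \<subseteq> {..<n}})"
proof (cases "k \<le> n")
  case True
  have "1 + real k * (- (real k / real n)) \<le> (1 + - (real k / real n)) ^ k"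
    using True assms by (intro Bernoulli_inequality) simp
  then have "real n ^ k * (1 - (real k)\<^sup>2 / real n) \<le> real n ^ k * (1 - real k / real n) ^ k"
    by (intro mult_left_mono) (auto simp: power2_eq_square)
  also have "\<dots> = real (n - k) ^ k"
  proof -
    have "real n * (1 - real k / real n) = real (n - k)"
      using assms True by (simp add: field_simps of_nat_diff)
    then show ?thesis by (simp only: power_mult_distrib[symmetric])
  qed
  also have "\<dots> = (\<Prod>i\<in>{n - k + 1..n}. real (n - k))" using True by simp
  also have "\<dots> \<le> (\<Prod>i\<in>{n - k + 1..n}. real i)" by (intro prod_mono) auto
  also have "\<dots> = real (card {xs. length xs = k \<and> distinct xs \<and> set xs \<subseteq> {..<n}})"
    using card_lists_distinct_length_eq[of "{..<n}" k] True by simp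
  finally show ?thesis .
next
  case False
  then have "real n * 1 \<le> real k * real k" using assms by (intro mult_mono) auto
  then have "1 - (real k)\<^sup>2 / real n \<le> 0" using assms by (simp add: power2_eq_square field_simps)
  then have "real n ^ k * (1 - (real k)\<^sup>2 / real n) \<le> 0" by (intro mult_nonneg_nonpos) auto
  then show ?thesis by linarith
qed

lemma card_snakes_ge:
  assumes n: "1 \<le> n" and t: "1 \<le> t"
  shows "(2 * real n) ^ (2 * t - 1) * (1 - (2 * real t)\<^sup>2 / real n) \<le> real (card (snakes n t))"
proof -
  let ?k = "2 * t - 1"
  let ?X = "{xs. length xs = ?k \<and> distinct xs \<and> set xs \<subseteq> {..<n}}"
  let ?B = "{bs :: bool list. set bs \<subseteq> UNIV \<and> length bs = ?k}"
  let ?inv = "\<lambda>(us, y, vs). (map fst (us @ y # vs), map snd (us @ y # vs))"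
  have "?X \<times> ?B \<subseteq> ?inv ` snakes n t"
  proof
    fix q assume "q \<in> ?X \<times> ?B"
    then obtain xs bs where q: "q = (xs, bs)" "length xs = ?k" "distinct xs" "set xs \<subseteq> {..<n}" "length bs = ?k"
      by auto
    define z where "z = zip xs bs"
    have lz: "length z = ?k" using q by (simp add: z_def)
    have zeq: "z = take (t - 1) z @ z ! (t - 1) # drop t z"
      using id_take_nth_drop[of "t - 1" z] lz t by simp
    have maps: "map fst z = xs" "map snd z = bs" using q by (auto simp: z_def)
    have sub: "set z \<subseteq> lits n" using q by (auto simp: z_def lits_def dest: set_zip_leftD)
    have mem: "(take (t - 1) z, z ! (t - 1), drop t z) \<in> snakes n t"
      unfolding snakes_def mem_Collect_eq prod.case zeq[symmetric] maps
      using sub lz t q(3) set_take_subset[of "t - 1" z] set_drop_subset[of t z] nth_mem[of "t - 1" z] by auto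
    have "?inv (take (t - 1) z, z ! (t - 1), drop t z) = q"
      unfolding prod.case zeq[symmetric] maps q(1) ..
    from this[symmetric] mem show "q \<in> ?inv ` snakes n t" by (rule image_eqI)
  qed
  then have "card (?X \<times> ?B) \<le> card (snakes n t)"
    by (rule surj_card_le[OF finite_snakes])
  then have "card ?X * 2 ^ ?k \<le> card (snakes n t)"
    using card_lists_length_eq[of "UNIV :: bool set" ?k] by (simp add: card_cartesian_product)
  then have card_le: "real (card ?X * 2 ^ ?k) \<le> real (card (snakes n t))" by (simp only: of_nat_le_iff)
  have "real n ^ ?k * (1 - (2 * real t)\<^sup>2 / real n) \<le> real (card ?X)"
  proof -
    have "(real ?k)\<^sup>2 \<le> (2 * real t)\<^sup>2" using t by (intro power_mono) auto
    then have "(real ?k)\<^sup>2 / real n \<le> (2 * real t)\<^sup>2 / real n" by (rule divide_right_mono) simp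
    then have "real n ^ ?k * (1 - (2 * real t)\<^sup>2 / real n) \<le> real n ^ ?k * (1 - (real ?k)\<^sup>2 / real n)"
      by (intro mult_left_mono diff_left_mono) auto
    also have "\<dots> \<le> real (card ?X)" by (rule card_distinct_lists_ge[OF n])
    finally show ?thesis .
  qed
  then have "real n ^ ?k * (1 - (2 * real t)\<^sup>2 / real n) * 2 ^ ?k \<le> real (card ?X) * 2 ^ ?k"
    by (rule mult_right_mono) simp
  also have "\<dots> = real (card ?X * 2 ^ ?k)" by simp
  also note card_le
  also have "real n ^ ?k * (1 - (2 * real t)\<^sup>2 / real n) * 2 ^ ?k
      = (2 * real n) ^ ?k * (1 - (2 * real t)\<^sup>2 / real n)"
    by (simp only: power_mult_distrib mult_ac)
  finally show ?thesis .
qed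

section \<open>Second moment estimate for snakes\<close>

text \<open>\<open>D\<close> is the expected number of snakes without the corrections for
  distinctness, and \<open>Q\<close> bounds the conditional one. Both have leading term \<kappa>^2
  (\<kappa> R)^(2(t-1)) 2n (p(1-p))^2; their ratio loses (1 + x)^(2(t-1)) by passing from \<kappa> R
  to \<open>\<theta>\<close>, and 1 + z by pivots on the pinned snake.\<close>

lemma prob_unsatisfiable_ge:
  fixes m n t :: nat and p c :: real
  assumes p: "0 < p" "p < 1" and n: "2 \<le> n" and t: "2 \<le> t" and m: "1 \<le> m" and c: "0 \<le> c"
  defines "\<kappa> \<equiv> real m * (2 / (real n * (real n - 1)))"
  defines "R \<equiv> 2 * real n * (p * (1 - p))"
  defines "\<theta> \<equiv> \<kappa> * (R + c * (4 * real t))"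
  assumes \<mu>: "2 powr (1 / t) \<le> \<theta>" "2 powr (1 / t) * (2 + c) \<le> \<theta> * c"
    and big: "4 \<le> \<kappa> * \<theta> ^ (t - 1)"
    and e: "(2 * real t)\<^sup>2 / real n \<le> 1" "(2 * real t)\<^sup>2 / real m \<le> 1"
  shows "(1 - (2 * real t)\<^sup>2 / real n) * (1 - (2 * real t)\<^sup>2 / real m) /
     (exp (2 * real t * (c * (4 * real t) / R)) * (1 + 4 * real t * (9 * (1 + c) * (real t)\<^sup>2)\<^sup>2 / (2 * real n * (p * (1 - p))\<^sup>2)))
    \<le> measure_pmf.prob (biased_formula p 2 m n) {F. \<not> satisfiable F}"
proof -
  define M where "M = biased_formula p 2 m n"
  define s where "s = p * (1 - p)"
  define C where "C = 4 * real t * (9 * (1 + c) * (real t)\<^sup>2)\<^sup>2"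
  define e1 where "e1 = (2 * real t)\<^sup>2 / real n"
  define e2 where "e2 = (2 * real t)\<^sup>2 / real m"
  define k where "k = 2 / (real n * (real n - 1))"
  define D where "D = \<kappa> ^ (2 * t) * (2 * real n) ^ (2 * t - 1) * s ^ (2 * t)"
  define x where "x = c * (4 * real t) / R"
  define z where "z = C / (2 * real n * s\<^sup>2)"
  define Q where "Q = (\<kappa> * \<theta> ^ (t - 1))\<^sup>2 * (2 * real n * s\<^sup>2 + C)"
  have s0: "0 < s" using p by (simp add: s_def)
  have R0: "0 < R" using p n by (simp add: R_def)
  have k0: "0 < k" using n by (simp add: k_def)
  have \<kappa>k: "\<kappa> = real m * k" by (simp add: \<kappa>_def k_def)
  have \<kappa>0: "0 < \<kappa>" using m k0 by (simp add: \<kappa>k)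
  have C0: "0 \<le> C" by (simp add: C_def)
  have x0: "0 \<le> x" using c R0 by (simp add: x_def)
  have z0: "0 \<le> z" using C0 s0 by (simp add: z_def)
  have D0: "0 < D" using \<kappa>0 n s0 by (simp add: D_def)
  have Q0: "0 < Q"
  proof -
    have "0 < 2 * real n * s\<^sup>2" using n s0 by simp
    moreover have "0 < (\<kappa> * \<theta> ^ (t - 1))\<^sup>2" using big by (intro zero_less_power) linarith
    ultimately show ?thesis unfolding Q_def using C0 by (metis add_pos_nonneg mult_pos_pos)
  qed
  let ?J = "snakes n t \<times> positions m (2 * t)"
  let ?Ev = "\<lambda>(S, f). occurs_at (snake_clauses S) f"
  have t1: "1 \<le> t" using t by simp
  have corr: "(\<Sum>j\<in>?J. measure_pmf.prob M (?Ev i \<inter> ?Ev j)) \<le> Q * measure_pmf.prob M (?Ev i)" if i: "i \<in> ?J" for i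
  proof -
    obtain S f where Sf: "i = (S, f)" "S \<in> snakes n t" "f \<in> positions m (2 * t)" using i by auto
    let ?W = "\<Sum>y\<in>lits n. walk_sum (snake_kernel p \<kappa> (snake_clauses S)) (lits n) (t - 1) (neg y) y *
                     walk_sum (snake_kernel p \<kappa> (snake_clauses S)) (lits n) (t - 1) y (neg y)"
    have "?W \<le> Q" unfolding Q_def C_def s_def
      by (rule snake_walk_bound[OF p t1 Sf(2) c]) (use \<kappa>0 \<mu> big in \<open>auto simp: \<theta>_def R_def\<close>)
    then have "?W * measure_pmf.prob M (?Ev i) \<le> Q * measure_pmf.prob M (?Ev i)"
      by (rule mult_right_mono) simp
    moreover have "(\<Sum>j\<in>?J. measure_pmf.prob M (?Ev i \<inter> ?Ev j)) \<le> ?W * measure_pmf.prob M (?Ev i)"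
      using snake_correlation[OF p n t1 Sf(2,3) meta_eq_to_obj_eq[OF \<kappa>_def]] unfolding M_def Sf(1)
      by (simp add: case_prod_unfold)
    ultimately show ?thesis by linarith
  qed
  have unsat: "(\<Union>j\<in>?J. ?Ev j) \<inter> set_pmf M \<subseteq> {F. \<not> satisfiable F}"
  proof
    fix F assume F: "F \<in> (\<Union>j\<in>?J. ?Ev j) \<inter> set_pmf M"
    then obtain S f where Sf: "S \<in> snakes n t" "f \<in> positions m (2 * t)" "F \<in> occurs_at (snake_clauses S) f" by auto
    have len: "length F = m" using F set_replicate_pmf_lists unfolding M_def biased_formula_def by blast
    have "set (snake_clauses S) \<subseteq> set F"
    proof
      fix C assume "C \<in> set (snake_clauses S)"
      moreover have "length f = length (snake_clauses S)"
        using Sf length_snake_clauses[OF Sf(1) t1] by (simp add: positions_def)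
      ultimately obtain i where i: "(i, C) \<in> set (zip f (snake_clauses S))" by (metis in_set_impl_in_set_zip2)
      then have "F ! i = C" "i \<in> set f" using Sf(3) by (auto simp: occurs_at_def dest: set_zip_leftD)
      then show "C \<in> set F" using Sf(2) len by (auto simp: positions_def)
    qed
    then show "F \<in> {F. \<not> satisfiable F}"
      using snake_unsatisfiable unfolding snake_clauses_def case_prod_unfold by blast
  qed
  have "(\<Sum>j\<in>?J. measure_pmf.prob M (?Ev j)) / Q \<le> measure_pmf.prob M (\<Union>j\<in>?J. ?Ev j)"
    by (rule second_moment_bound[OF _ Q0 corr]) auto
  also have "\<dots> = measure_pmf.prob M ((\<Union>j\<in>?J. ?Ev j) \<inter> set_pmf M)"
    by (rule measure_Int_set_pmf[symmetric])
  also have "\<dots> \<le> measure_pmf.prob M {F. \<not> satisfiable F}"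
    by (rule measure_pmf.finite_measure_mono[OF unsat]) simp
  finally have main: "(\<Sum>j\<in>?J. measure_pmf.prob M (?Ev j)) / Q \<le> measure_pmf.prob M {F. \<not> satisfiable F}" .
  have EX: "D * ((1 - e1) * (1 - e2)) \<le> (\<Sum>j\<in>?J. measure_pmf.prob M (?Ev j))"
  proof -
    have "(\<Sum>j\<in>?J. measure_pmf.prob M (?Ev j)) = (\<Sum>j\<in>?J. (k * s) ^ (2 * t))"
      by (intro sum.cong refl) (auto simp: M_def k_def s_def prob_snake_occurs[OF p n t])
    also have "\<dots> = real (card (snakes n t)) * real (card (positions m (2 * t))) * (k * s) ^ (2 * t)"
      by (simp add: card_cartesian_product)
    also have "\<dots> \<ge> ((2 * real n) ^ (2 * t - 1) * (1 - e1)) * (real m ^ (2 * t) * (1 - e2)) * (k * s) ^ (2 * t)"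
    proof (intro mult_right_mono mult_mono)
      show "(2 * real n) ^ (2 * t - 1) * (1 - e1) \<le> real (card (snakes n t))"
        unfolding e1_def using n t by (intro card_snakes_ge) auto
      show "real m ^ (2 * t) * (1 - e2) \<le> real (card (positions m (2 * t)))"
        using card_distinct_lists_ge[OF m, of "2 * t"] unfolding e2_def positions_def by simp
    qed (use e k0 s0 in \<open>auto simp: e1_def e2_def\<close>)
    also have "((2 * real n) ^ (2 * t - 1) * (1 - e1)) * (real m ^ (2 * t) * (1 - e2)) * (k * s) ^ (2 * t) = D * ((1 - e1) * (1 - e2))"
      by (simp add: D_def \<kappa>k power_mult_distrib mult_ac)
    finally show ?thesis .
  qed
  have QD: "Q \<le> D * (exp (2 * real t * x) * (1 + z))"
  proof -
    have th: "\<theta> = \<kappa> * R * (1 + x)" using R0 by (simp add: \<theta>_def x_def field_simps)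
    have tt: "2 * t = 2 + 2 * (t - 1)" "2 * t - 1 = 1 + 2 * (t - 1)" using t by auto
    have "Q = \<kappa>\<^sup>2 * (\<kappa> * R * (1 + x)) ^ (2 * (t - 1)) * (2 * real n * s\<^sup>2 + C)"
      unfolding Q_def th by (simp add: power_mult_distrib power_mult[symmetric] mult.commute[of 2])
    also have "2 * real n * s\<^sup>2 + C = 2 * real n * s\<^sup>2 * (1 + z)" using n s0 by (simp add: z_def field_simps)
    also have "\<kappa>\<^sup>2 * (\<kappa> * R * (1 + x)) ^ (2 * (t - 1)) * (2 * real n * s\<^sup>2 * (1 + z)) = D * ((1 + x) ^ (2 * (t - 1)) * (1 + z))"
      unfolding D_def R_def s_def[symmetric] tt(2) unfolding tt(1) power_add power_mult_distrib power_one_right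
      by (simp only: ac_simps)
    also have "\<dots> \<le> D * (exp (2 * real t * x) * (1 + z))"
    proof -
      have "(1 + x) ^ (2 * (t - 1)) \<le> (1 + x) ^ (2 * t)" using x0 by (intro power_increasing) auto
      also have "\<dots> \<le> exp x ^ (2 * t)" using x0 by (intro power_mono) auto
      also have "\<dots> = exp (2 * real t * x)" by (simp add: exp_of_nat_mult[symmetric])
      finally show ?thesis using D0 z0 by (intro mult_left_mono mult_right_mono) auto
    qed
    finally show ?thesis .
  qed
  have "(1 - e1) * (1 - e2) / (exp (2 * real t * x) * (1 + z)) = D * ((1 - e1) * (1 - e2)) / (D * (exp (2 * real t * x) * (1 + z)))"
    using D0 by simp
  also have "\<dots> \<le> D * ((1 - e1) * (1 - e2)) / Q"
    using QD Q0 D0 e by (intro divide_left_mono) (auto simp: e1_def e2_def intro!: mult_pos_pos mult_nonneg_nonneg add_pos_nonneg z0)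
  also have "\<dots> \<le> (\<Sum>j\<in>?J. measure_pmf.prob M (?Ev j)) / Q"
    using EX Q0 by (intro divide_right_mono) auto
  also note main
  finally show ?thesis by (simp add: e1_def e2_def x_def z_def C_def s_def M_def)
qed

section \<open>The threshold\<close>

text \<open>One factor \<open>sqrt \<rho> ^ s\<close> swallows the polynomial, the other is
  summable.\<close>

lemma summable_square_times_power:
  fixes \<rho> :: real
  assumes "0 < \<rho>" "\<rho> < 1"
  shows "summable (\<lambda>s. 4 * (real s)\<^sup>2 * \<rho> ^ s)"
proof (rule summable_comparison_test_bigo)
  have "sqrt \<rho> < 1" "0 < sqrt \<rho>" using assms by auto
  then show "summable (\<lambda>s. norm (sqrt \<rho> ^ s))" by (simp add: summable_geometric)
  have "(\<lambda>s. 4 * (real s)\<^sup>2 * (sqrt \<rho>) ^ s) \<in> O(\<lambda>_. 1)"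
    using \<open>sqrt \<rho> < 1\<close> \<open>0 < sqrt \<rho>\<close> by real_asymp
  then have "(\<lambda>s. (4 * (real s)\<^sup>2 * (sqrt \<rho>) ^ s) * sqrt \<rho> ^ s) \<in> O(\<lambda>s. 1 * sqrt \<rho> ^ s)"
    by (rule landau_o.big.mult) simp
  then show "(\<lambda>s. 4 * (real s)\<^sup>2 * \<rho> ^ s) \<in> O(\<lambda>s. sqrt \<rho> ^ s)"
    using assms by (simp add: mult.assoc power_mult_distrib[symmetric])
qed

lemma biased_2SAT_below_threshold:
  fixes p \<epsilon> :: real and m :: "nat \<Rightarrow> nat"
  assumes p: "0 < p" "p < 1" and \<epsilon>: "0 < \<epsilon>"
    and m: "\<forall>\<^sub>F n in sequentially. real (m n) \<le> (1 - \<epsilon>) * (1 / (4 * p * (1 - p)) * real n)"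
  shows "(\<lambda>n. measure_pmf.prob (biased_formula p 2 (m n) n) {F. satisfiable F}) \<longlonglongrightarrow> 1"
proof -
  define \<alpha> where "\<alpha> = 1 / (4 * p * (1 - p))"
  \<comment> \<open>The cap keeps 1 - \<delta> positive even when \<epsilon> \<ge> 1. Below,
    \<open>\<rho>\<close> lies strictly between 1 - \<delta> and 1 to absorb the factor n / (n -
    1).\<close>
  define \<delta> where "\<delta> = min \<epsilon> (1 / 2)"
  have \<delta>: "0 < \<delta>" "\<delta> \<le> 1 / 2" "\<delta> \<le> \<epsilon>" using \<epsilon> by (auto simp: \<delta>_def)
  have \<alpha>: "0 < \<alpha>" using p by (simp add: \<alpha>_def)
  define \<rho> where "\<rho> = 1 - \<delta> / 2"
  have \<rho>: "0 < \<rho>" "\<rho> < 1" using \<delta> by (auto simp: \<rho>_def)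
  define B where "B = (\<Sum>s. 4 * (real s)\<^sup>2 * \<rho> ^ s)"
  have m': "\<forall>\<^sub>F n in sequentially. real (m n) \<le> (1 - \<delta>) * \<alpha> * real n"
    using m
  proof eventually_elim
    case (elim n)
    have "(1 - \<epsilon>) * (\<alpha> * real n) \<le> (1 - \<delta>) * (\<alpha> * real n)" using \<delta> \<alpha> by (intro mult_right_mono) auto
    then show ?case using elim unfolding \<alpha>_def[symmetric] by simp
  qed
  have ev: "\<forall>\<^sub>F n in sequentially. (1 - \<delta>) * (real n / (real n - 1)) \<le> \<rho>"
  proof -
    have "(\<lambda>n. (1 - \<delta>) * (real n / (real n - 1))) \<longlonglongrightarrow> 1 - \<delta>" by real_asymp
    then have "\<forall>\<^sub>F n in sequentially. (1 - \<delta>) * (real n / (real n - 1)) < \<rho>"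
      by (rule order_tendstoD(2)) (use \<delta> in \<open>simp add: \<rho>_def\<close>)
    then show ?thesis by (rule eventually_mono) simp
  qed
  have bound: "\<forall>\<^sub>F n in sequentially. measure_pmf.prob (biased_formula p 2 (m n) n) {F. \<not> satisfiable F}
      \<le> 2 * \<alpha> * B / (real n - 1)"
    using m' ev eventually_ge_at_top[of 2]
  proof eventually_elim
    case (elim n)
    define k where "k = 2 / (real n * (real n - 1))"
    have k: "0 < k" using elim by (simp add: k_def)
    let ?r = "2 * real n * (real (m n) * k) * (p * (1 - p))"
    have "real (m n) * k \<le> (1 - \<delta>) * \<alpha> * real n * k" using elim k by (intro mult_right_mono) auto
    also have nk: "\<dots> = (1 - \<delta>) * \<alpha> * (2 / (real n - 1))" using elim by (simp add: k_def)
    finally have mk: "real (m n) * k \<le> (1 - \<delta>) * \<alpha> * (2 / (real n - 1))" .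
    have "(1 - \<delta>) * \<alpha> * (2 / (real n - 1)) \<le> 1 * \<alpha> * (2 / (real n - 1))"
      using \<delta> \<alpha> elim by (intro mult_right_mono) auto
    then have mk2: "real (m n) * k \<le> 2 * \<alpha> / (real n - 1)" using mk by simp
    have r0: "0 \<le> ?r" using p k by simp
    have "?r \<le> 2 * real n * ((1 - \<delta>) * \<alpha> * (2 / (real n - 1))) * (p * (1 - p))"
      using mk p by (intro mult_left_mono mult_right_mono) auto
    also have "\<dots> = (1 - \<delta>) * (real n / (real n - 1)) * (\<alpha> * (4 * p * (1 - p)))" by simp
    also have "\<alpha> * (4 * p * (1 - p)) = 1" using p by (simp add: \<alpha>_def)
    finally have r: "?r \<le> \<rho>" using elim by simp
    have "(\<Sum>s\<le>n. 4 * (real s)\<^sup>2 * ?r ^ s) \<le> (\<Sum>s\<le>n. 4 * (real s)\<^sup>2 * \<rho> ^ s)"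
      using r r0 by (intro sum_mono mult_left_mono power_mono) auto
    also have "\<dots> \<le> B" unfolding B_def
      by (intro sum_le_suminf summable_square_times_power \<rho>) (use \<rho> in auto)
    finally have sB: "(\<Sum>s\<le>n. 4 * (real s)\<^sup>2 * ?r ^ s) \<le> B" .
    have "measure_pmf.prob (biased_formula p 2 (m n) n) {F. \<not> satisfiable F} \<le> real (m n) * k * (\<Sum>s\<le>n. 4 * (real s)\<^sup>2 * ?r ^ s)"
      unfolding k_def using prob_unsatisfiable_le[OF p, of n "m n"] elim by simp
    also have "\<dots> \<le> (2 * \<alpha> / (real n - 1)) * B"
      using mk2 sB k \<alpha> elim p r0 by (intro mult_mono sum_nonneg) auto
    finally show ?case by simp
  qed
  have "(\<lambda>n. measure_pmf.prob (biased_formula p 2 (m n) n) {F. \<not> satisfiable F}) \<longlonglongrightarrow> 0"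
  proof (rule tendsto_sandwich[OF _ bound tendsto_const])
    show "(\<lambda>n. 2 * \<alpha> * B / (real n - 1)) \<longlonglongrightarrow> 0" by real_asymp
  qed simp
  then have "(\<lambda>n. 1 - measure_pmf.prob (biased_formula p 2 (m n) n) {F. \<not> satisfiable F}) \<longlonglongrightarrow> 1 - 0"
    by (intro tendsto_intros)
  moreover have "1 - measure_pmf.prob M {F. \<not> satisfiable F} = measure_pmf.prob M {F. satisfiable F}" for M
    using measure_pmf.prob_compl[of "{F. \<not> satisfiable F}" M] by (simp add: Compl_eq_Diff_UNIV[symmetric] Collect_neg_eq[symmetric])
  ultimately show ?thesis by simp
qed

lemma biased_2SAT_above_threshold:
  fixes p \<epsilon> :: real and m :: "nat \<Rightarrow> nat"
  assumes p: "0 < p" "p < 1" and \<epsilon>: "0 < \<epsilon>"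
    and m: "\<forall>\<^sub>F n in sequentially. real (m n) \<ge> (1 + \<epsilon>) * (1 / (4 * p * (1 - p)) * real n)"
  shows "(\<lambda>n. measure_pmf.prob (biased_formula p 2 (m n) n) {F. \<not> satisfiable F}) \<longlonglongrightarrow> 1"
proof -
  define s where "s = p * (1 - p)"
  define \<alpha> where "\<alpha> = 1 / (4 * s)"
  \<comment> \<open>The solution of (1 + \<epsilon>/2)(2 + c) = (1 + \<epsilon>) c: the rate
    \<open>2 powr (1 / t)\<close> is eventually at most 1 + \<epsilon>/2, while
    \<open>\<theta>\<close> is at least 1 + \<epsilon>.\<close>
  define c where "c = (4 + 2 * \<epsilon>) / \<epsilon>"
  \<comment> \<open>Any exponent strictly between 0 and 1/5 would do: t^5 / n must vanish while (1 +
    \<epsilon>)^t outgrows n.\<close>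
  define t where "t n = nat \<lceil>real n powr (1 / 7)\<rceil>" for n :: nat
  have s: "0 < s" "s \<le> 1"
  proof -
    show "0 < s" using p by (simp add: s_def)
    have "p * (1 - p) \<le> 1 * 1" using p by (intro mult_mono) auto
    then show "s \<le> 1" by (simp add: s_def)
  qed
  have \<alpha>: "0 < \<alpha>" using s by (simp add: \<alpha>_def)
  have c: "0 < c" using \<epsilon> by (simp add: c_def)
  have t_ge: "real n powr (1 / 7) \<le> real (t n)" for n unfolding t_def by linarith
  have t_le: "real (t n) \<le> real n powr (1 / 7) + 1" for n unfolding t_def by simp
  have t_top: "filterlim (\<lambda>n. real (t n)) at_top sequentially"
  proof (rule filterlim_at_top_mono)
    show "filterlim (\<lambda>n. real n powr (1 / 7)) at_top sequentially" by real_asymp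
  qed (simp add: t_ge)
  have t5: "(\<lambda>n. real (t n) ^ 5 / real n) \<longlonglongrightarrow> 0"
  proof (rule tendsto_sandwich[OF _ _ tendsto_const])
    show "(\<lambda>n. (real n powr (1 / 7) + 1) ^ 5 / real n) \<longlonglongrightarrow> 0" by real_asymp
    show "\<forall>\<^sub>F n in sequentially. real (t n) ^ 5 / real n \<le> (real n powr (1 / 7) + 1) ^ 5 / real n"
      by (intro always_eventually allI divide_right_mono power_mono t_le) auto
  qed simp
  have t2: "(\<lambda>n. real (t n) ^ 2 / real n) \<longlonglongrightarrow> 0"
  proof (rule tendsto_sandwich[OF _ _ tendsto_const])
    show "(\<lambda>n. (real n powr (1 / 7) + 1) ^ 2 / real n) \<longlonglongrightarrow> 0" by real_asymp
    show "\<forall>\<^sub>F n in sequentially. real (t n) ^ 2 / real n \<le> (real n powr (1 / 7) + 1) ^ 2 / real n"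
      by (intro always_eventually allI divide_right_mono power_mono t_le) auto
  qed simp
  have t2m: "(\<lambda>n. real (t n) ^ 2 / real (m n)) \<longlonglongrightarrow> 0"
  proof (rule tendsto_sandwich[OF _ _ tendsto_const])
    show "(\<lambda>n. real (t n) ^ 2 / real n * (1 / \<alpha>)) \<longlonglongrightarrow> 0" using tendsto_mult_left_zero[OF t2] .
    show "\<forall>\<^sub>F n in sequentially. real (t n) ^ 2 / real (m n) \<le> real (t n) ^ 2 / real n * (1 / \<alpha>)"
      using m eventually_gt_at_top[of 0]
    proof eventually_elim
      case (elim n)
      have "1 * (\<alpha> * real n) \<le> (1 + \<epsilon>) * (\<alpha> * real n)" using \<epsilon> \<alpha> by (intro mult_right_mono) auto
      then have "\<alpha> * real n \<le> real (m n)" using elim unfolding \<alpha>_def s_def by (simp add: mult.assoc)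
      moreover have "0 < \<alpha> * real n" using \<alpha> elim by simp
      ultimately have "real (t n) ^ 2 / real (m n) \<le> real (t n) ^ 2 / (\<alpha> * real n)"
        by (intro divide_left_mono) auto
      then show ?case by (simp add: mult.commute)
    qed
  qed simp
  define L where "L n = (1 - (2 * real (t n))\<^sup>2 / real n) * (1 - (2 * real (t n))\<^sup>2 / real (m n)) /
     (exp (2 * real (t n) * (c * (4 * real (t n)) / (2 * real n * (p * (1 - p))))) *
       (1 + 4 * real (t n) * (9 * (1 + c) * (real (t n))\<^sup>2)\<^sup>2 / (2 * real n * (p * (1 - p))\<^sup>2)))" for n
  have L: "L \<longlonglongrightarrow> 1"
  proof -
    have L_eq: "L = (\<lambda>n. (1 - 4 * (real (t n) ^ 2 / real n)) * (1 - 4 * (real (t n) ^ 2 / real (m n))) /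
      (exp (4 * c / s * (real (t n) ^ 2 / real n)) * (1 + 162 * (1 + c)\<^sup>2 / s\<^sup>2 * (real (t n) ^ 5 / real n))))"
    proof
      fix n
      have "2 * real (t n) * (c * (4 * real (t n)) / (2 * real n * s)) = 4 * c / s * (real (t n) ^ 2 / real n)"
        by (simp add: power2_eq_square)
      moreover have "4 * real (t n) * (9 * (1 + c) * (real (t n))\<^sup>2)\<^sup>2 / (2 * real n * s\<^sup>2)
         = 162 * (1 + c)\<^sup>2 / s\<^sup>2 * (real (t n) ^ 5 / real n)"
      proof -
        have "4 * x * (9 * d * x\<^sup>2)\<^sup>2 / (2 * y * s\<^sup>2) = 162 * d\<^sup>2 / s\<^sup>2 * (x ^ 5 / y)" for x d y :: real
          by (simp add: power_mult_distrib eval_nat_numeral)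
        then show ?thesis .
      qed
      ultimately show "L n = (1 - 4 * (real (t n) ^ 2 / real n)) * (1 - 4 * (real (t n) ^ 2 / real (m n))) /
      (exp (4 * c / s * (real (t n) ^ 2 / real n)) * (1 + 162 * (1 + c)\<^sup>2 / s\<^sup>2 * (real (t n) ^ 5 / real n)))"
        unfolding L_def s_def[symmetric] by (simp add: power_mult_distrib)
    qed
    have "L \<longlonglongrightarrow> (1 - 4 * 0) * (1 - 4 * 0) / (exp (4 * c / s * 0) * (1 + 162 * (1 + c)\<^sup>2 / s\<^sup>2 * 0))"
      unfolding L_eq by (intro tendsto_intros t2 t2m t5) auto
    then show ?thesis by simp
  qed
  have e1: "\<forall>\<^sub>F n in sequentially. real (t n) ^ 2 / real n < 1 / 4" by (rule order_tendstoD(2)[OF t2]) simp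
  have e2: "\<forall>\<^sub>F n in sequentially. real (t n) ^ 2 / real (m n) < 1 / 4" by (rule order_tendstoD(2)[OF t2m]) simp
  have e3: "\<forall>\<^sub>F n in sequentially. 2 \<le> real (t n)" using t_top unfolding filterlim_at_top by blast
  have e4: "\<forall>\<^sub>F n in sequentially. 2 powr (1 / real (t n)) \<le> 1 + \<epsilon> / 2"
  proof -
    have "((\<lambda>x::real. 2 powr (1 / x)) \<longlongrightarrow> 1) at_top" by real_asymp
    then have "(\<lambda>n. 2 powr (1 / real (t n))) \<longlonglongrightarrow> 1" by (rule filterlim_compose[OF _ t_top])
    then have "\<forall>\<^sub>F n in sequentially. 2 powr (1 / real (t n)) < 1 + \<epsilon> / 2"
      by (rule order_tendstoD(2)) (use \<epsilon> in simp)
    then show ?thesis by (rule eventually_mono) simp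
  qed
  \<comment> \<open>The growth behind \<open>big\<close>: 8n dominates 4R, and \<open>R\<close>
    cancels against the factor \<open>\<kappa> * R\<close>, which is at least 1 +
    \<epsilon>.\<close>
  have e5: "\<forall>\<^sub>F n in sequentially. 8 * real n \<le> (1 + \<epsilon>) ^ t n"
  proof -
    have "\<forall>\<^sub>F n in sequentially. 8 * real n \<le> (1 + \<epsilon>) powr (real n powr (1 / 7))"
      using \<epsilon> by real_asymp
    then show ?thesis
    proof eventually_elim
      case (elim n)
      also have "(1 + \<epsilon>) powr (real n powr (1 / 7)) \<le> (1 + \<epsilon>) powr real (t n)"
        using \<epsilon> t_ge by (intro powr_mono) auto
      also have "\<dots> = (1 + \<epsilon>) ^ t n" using \<epsilon> by (simp add: powr_realpow)
      finally show ?case .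
    qed
  qed
  have lower: "\<forall>\<^sub>F n in sequentially. L n \<le> measure_pmf.prob (biased_formula p 2 (m n) n) {F. \<not> satisfiable F}"
    using m e1 e2 e3 e4 e5 eventually_ge_at_top[of 2]
  proof eventually_elim
    case (elim n)
    define \<kappa> where "\<kappa> = real (m n) * (2 / (real n * (real n - 1)))"
    define R where "R = 2 * real n * (p * (1 - p))"
    define \<theta> where "\<theta> = \<kappa> * (R + c * (4 * real (t n)))"
    have n: "2 \<le> n" using elim by simp
    have R0: "0 < R" using p n by (simp add: R_def)
    have mn: "(1 + \<epsilon>) * (\<alpha> * real n) \<le> real (m n)" using elim(1) by (simp add: \<alpha>_def s_def mult.assoc)
    have "0 < (1 + \<epsilon>) * (\<alpha> * real n)" using \<epsilon> \<alpha> n by simp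
    then have mpos: "0 < real (m n)" using mn by linarith
    then have m1: "1 \<le> m n" by simp
    have \<kappa>0: "0 < \<kappa>" using mpos n by (simp add: \<kappa>_def)
    \<comment> \<open>Here \<kappa> R = 4p(1-p) m / (n - 1), so replacing n - 1 by n errs in the
      favourable direction.\<close>
    have r: "1 + \<epsilon> \<le> \<kappa> * R"
    proof -
      have "1 + \<epsilon> = (1 + \<epsilon>) * (\<alpha> * real n) * (4 * s / real n)" using s n by (simp add: \<alpha>_def)
      also have "\<dots> \<le> real (m n) * (4 * s / real n)" using mn s by (intro mult_right_mono) auto
      also have "\<dots> \<le> real (m n) * (4 * s / (real n - 1))"
        using s n by (intro mult_left_mono divide_left_mono) auto
      also have "\<dots> = \<kappa> * R" using n by (simp add: \<kappa>_def R_def s_def field_simps)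
      finally show ?thesis .
    qed
    have "\<kappa> * R \<le> \<theta>" unfolding \<theta>_def using \<kappa>0 c by (intro mult_left_mono) auto
    then have \<theta>: "1 + \<epsilon> \<le> \<theta>" using r by linarith
    have mu1: "2 powr (1 / real (t n)) \<le> \<theta>" using elim(5) \<theta> \<epsilon> by linarith
    have "2 powr (1 / real (t n)) * (2 + c) \<le> (1 + \<epsilon> / 2) * (2 + c)"
      using elim(5) c by (intro mult_right_mono) auto
    also have "\<dots> = (1 + \<epsilon>) * c" using \<epsilon> by (simp add: c_def field_simps)
    also have "\<dots> \<le> \<theta> * c" using \<theta> c by (intro mult_right_mono) auto
    finally have mu2: "2 powr (1 / real (t n)) * (2 + c) \<le> \<theta> * c" .
    have big: "4 \<le> \<kappa> * \<theta> ^ (t n - 1)"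
    proof -
      have "Suc (t n - 1) = t n" using elim(4) by simp
      have "4 * R \<le> 8 * real n"
        using mult_left_mono[OF s(2), of "8 * real n"] by (simp add: R_def s_def)
      also have "\<dots> \<le> (1 + \<epsilon>) ^ t n" by (rule elim(6))
      also have "\<dots> = (1 + \<epsilon>) * (1 + \<epsilon>) ^ (t n - 1)" using \<open>Suc (t n - 1) = t n\<close> by (metis power_Suc)
      also have "\<dots> \<le> (\<kappa> * R) * \<theta> ^ (t n - 1)"
        using r \<theta> \<epsilon> by (intro mult_mono power_mono) auto
      finally have "4 * R \<le> (\<kappa> * \<theta> ^ (t n - 1)) * R" by (simp add: mult_ac)
      then show ?thesis using R0 by simp
    qed
    show ?case unfolding L_def
    proof (rule prob_unsatisfiable_ge[OF p n _ m1])
      show "2 \<le> t n" using elim(4) by simp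
      show "0 \<le> c" using c by simp
      show "(2 * real (t n))\<^sup>2 / real n \<le> 1" "(2 * real (t n))\<^sup>2 / real (m n) \<le> 1"
        using elim(2,3) by (auto simp: power_mult_distrib mult.commute)
    qed (use mu1 mu2 big in \<open>simp_all add: \<kappa>_def R_def \<theta>_def\<close>)
  qed
  show ?thesis
    by (rule tendsto_sandwich[OF lower _ L tendsto_const]) simp
qed

theorem theorem2:
  fixes p b :: real
  assumes "0 < p" and "p < 1" and "p = 1 / 2 - b"
  shows "1 / (4 * p * (1 - p)) = 1 / (1 - 4 * b\<^sup>2) \<and>
         sharp_sat_threshold p 2 (1 / (4 * p * (1 - p)))"
proof
  have "4 * p * (1 - p) = 1 - 4 * b\<^sup>2" unfolding assms(3) by (simp add: power2_eq_square algebra_simps)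
  then show "1 / (4 * p * (1 - p)) = 1 / (1 - 4 * b\<^sup>2)" by simp
  show "sharp_sat_threshold p 2 (1 / (4 * p * (1 - p)))"
    unfolding sharp_sat_threshold_def
    using biased_2SAT_below_threshold[OF assms(1,2)] biased_2SAT_above_threshold[OF assms(1,2)] by blast
qed

end
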